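(* Every 3-connected cubic graph of path-width 4 has a 3-decomposition.
   Context: All graphs are finite and simple; cubic means 3-regular. A 3-decomposition of a graph $G$ is a partition of $E(G)$ into the edge sets of a spanning tree, a (possibly empty) 2-regular subgraph, and a (possibly empty) matching. *)

theory Defs
  imports Main
begin

definition simple_graph :: "'a set \<Rightarrow> 'a set set \<Rightarrow> bool" where
  "simple_graph V E \<longleftrightarrow> finite V \<and> (\<forall>e\<in>E. e \<subseteq> V \<and> card e = 2)"

definition degree :: "'a set set \<Rightarrow> 'a \<Rightarrow> nat" where
  "degree E v = card {e\<in>E. v \<in> e}"

definition cubic :: "'a set \<Rightarrow> 'a set set \<Rightarrow> bool" where
  "cubic V E \<longleftrightarrow> (\<forall>v\<in>V. degree E v = 3)"

definition connected_on :: "'a set \<Rightarrow> 'a set set \<Rightarrow> bool" where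
  "connected_on V F \<longleftrightarrow> (\<forall>u\<in>V. \<forall>v\<in>V. (\<lambda>x y. {x, y} \<in> F)\<^sup>*\<^sup>* u v)"

definition induced_edges :: "'a set set \<Rightarrow> 'a set \<Rightarrow> 'a set set" where
  "induced_edges E W = {e\<in>E. e \<subseteq> W}"

definition k_connected :: "nat \<Rightarrow> 'a set \<Rightarrow> 'a set set \<Rightarrow> bool" where
  "k_connected k V E \<longleftrightarrow> card V > k \<and>
     (\<forall>S\<subseteq>V. card S < k \<longrightarrow> connected_on (V - S) (induced_edges E (V - S)))"

definition path_decomposition :: "'a set \<Rightarrow> 'a set set \<Rightarrow> 'a set list \<Rightarrow> bool" where
  "path_decomposition V E Xs \<longleftrightarrow> Xs \<noteq> [] \<and>
     (\<forall>X\<in>set Xs. X \<subseteq> V) \<and> \<Union>(set Xs) = V \<and>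
     (\<forall>e\<in>E. \<exists>X\<in>set Xs. e \<subseteq> X) \<and>
     (\<forall>i j k. i \<le> j \<longrightarrow> j \<le> k \<longrightarrow> k < length Xs \<longrightarrow> Xs ! i \<inter> Xs ! k \<subseteq> Xs ! j)"

definition pd_width :: "'a set list \<Rightarrow> nat" where
  "pd_width Xs = Max (card ` set Xs) - 1"

definition pathwidth :: "'a set \<Rightarrow> 'a set set \<Rightarrow> nat" where
  "pathwidth V E = (LEAST w. \<exists>Xs. path_decomposition V E Xs \<and> pd_width Xs = w)"

definition is_cycle :: "'a set set \<Rightarrow> bool" where
  "is_cycle C \<longleftrightarrow> C \<noteq> {} \<and> connected_on (\<Union>C) C \<and> (\<forall>v\<in>\<Union>C. degree C v = 2)"

definition acyclic_edges :: "'a set set \<Rightarrow> bool" where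
  "acyclic_edges F \<longleftrightarrow> \<not> (\<exists>C\<subseteq>F. is_cycle C)"

definition spanning_tree :: "'a set \<Rightarrow> 'a set set \<Rightarrow> 'a set set \<Rightarrow> bool" where
  "spanning_tree V E T \<longleftrightarrow> T \<subseteq> E \<and> connected_on V T \<and> acyclic_edges T"

text \<open>A (possibly empty) 2-regular subgraph, given by its edge set; its vertices
  are those covered by its edges.\<close>

definition two_regular_sub :: "'a set set \<Rightarrow> 'a set set \<Rightarrow> bool" where
  "two_regular_sub E C \<longleftrightarrow> C \<subseteq> E \<and> (\<forall>v\<in>\<Union>C. degree C v = 2)"

definition matching :: "'a set set \<Rightarrow> 'a set set \<Rightarrow> bool" where
  "matching E M \<longleftrightarrow> M \<subseteq> E \<and> (\<forall>e\<in>M. \<forall>f\<in>M. e \<noteq> f \<longrightarrow> e \<inter> f = {})"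

definition three_decomposition :: "'a set \<Rightarrow> 'a set set \<Rightarrow> bool" where
  "three_decomposition V E \<longleftrightarrow> (\<exists>T C M.
     spanning_tree V E T \<and> two_regular_sub E C \<and> matching E M \<and>
     T \<union> C \<union> M = E \<and> T \<inter> C = {} \<and> T \<inter> M = {} \<and> C \<inter> M = {})"

end

theory Submission
  imports Defs "HOL-Library.Multiset"
begin

text \<open>Call a fragment a set of vertices, and its type the labels (tree, cycle, matching) that a partial
  decomposition gives to the cut edges, together with the partition of the tree edges among them by the components
  of the forest inside the fragment. Whether a partial decomposition extends depends only on its type.

  A path decomposition of width 4 has separators of at most 4 vertices. Moving each separator vertex to the side
  where most of its neighbours lie gives edge cuts of size at most 4, and by submodularity these cuts can be taken nested.
  Consecutive cuts differ by at most 5 vertices, and as 3-connectivity forces all cuts to have at least 3 edges,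
  refining the chain leaves only few local steps: adding one vertex, a rung (two adjacent vertices), or
  one of three configurations on four vertices (claw, square, triangle).

  A finite family of sets of types is closed under these steps: whenever the fragment before a step realises all types
  of some member, the fragment after it realises all types of another member. The family contains a set realised
  by a single vertex, and each of its members for cuts of size 3 contains a type that the last vertex
  completes to a 3-decomposition.\<close>

subsection \<open>Partial decompositions\<close>

text \<open>While a fragment grows, the rest of the graph is unknown, and one realised type may turn
  out to be a dead end. Hence the invariant is a disjunction of conjunctions: the fragment realises
  every type of some member of the family, with no control over which member. What limits the local
  steps is a count. Adding a set D changes the size of the cut by 3|D| minus twice the number of
  edges inside D or between D and the fragment. If no set strictly in between has a cut of at most 4
  edges, then either |D| = 1, or both cuts have exactly 4 edges (a smaller one contradicts
  3-connectivity) and |D| is even. Bags have at most 5 vertices, so |D| is then 2 or 4; for |D| = 4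
  the edges counted number exactly 6, which few graphs on D allow. These steps cannot be broken up
  without passing through cuts of 5 or 6 edges. The family need not speak of such cuts, because the
  moves of a whole configuration are evaluated at once. The final tree is connected because no move
  hides a forest component: each must keep a tree edge in the cut until the last vertex fuses them
  all.\<close>

lemma handshake:
  assumes "finite W" "finite K" "\<And>e. e \<in> K \<Longrightarrow> e \<subseteq> W \<and> card e = 2"
  shows "(\<Sum>w\<in>W. degree K w) = 2 * card K"
proof -
  have "(\<Sum>w\<in>W. degree K w) = (\<Sum>w\<in>W. \<Sum>e\<in>K. if w \<in> e then 1 else 0)"
    unfolding degree_def using assms(2) by (intro sum.cong refl) (simp add: sum.If_cases Int_def)
  also have "\<dots> = (\<Sum>e\<in>K. \<Sum>w\<in>W. if w \<in> e then 1 else 0)" by (rule sum.swap)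
  also have "\<dots> = (\<Sum>e\<in>K. card e)"
  proof (intro sum.cong refl)
    fix e assume "e \<in> K"
    then have "{w \<in> W. w \<in> e} = e" using assms(3) by blast
    then show "(\<Sum>w\<in>W. if w \<in> e then 1 else 0) = card e"
      using assms(1) by (simp add: sum.If_cases Int_def)
  qed
  also have "\<dots> = 2 * card K" using assms(3) by simp
  finally show ?thesis .
qed

text \<open>A cycle through v uses exactly two edges at v, ending in different g-classes. Summing the degrees of the
  cycle over one of these classes then gives an odd number, contradicting the handshake lemma.\<close>

lemma acyclic_edges_add_star:
  assumes F: "acyclic_edges F" "finite F" "\<And>e. e \<in> F \<Longrightarrow> card e = 2" "v \<notin> \<Union>F"
    and U: "finite U" "v \<notin> U"
    and g: "\<And>x y. {x, y} \<in> F \<Longrightarrow> g x = g y" "inj_on g U"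
  shows "acyclic_edges (F \<union> (\<lambda>u. {v, u}) ` U)"
  unfolding acyclic_edges_def
proof
  let ?N = "(\<lambda>u. {v, u}) ` U"
  assume "\<exists>C\<subseteq>F \<union> ?N. is_cycle C"
  then obtain C where C: "C \<subseteq> F \<union> ?N" "is_cycle C" by blast
  have fC: "finite C" using C(1) F(2) U(1) by (meson finite_UnI finite_imageI finite_subset)
  have card2: "card e = 2" if "e \<in> C" for e
    using that C(1) F(3) U(2) by (auto simp: card_insert_if)
  have vC: "v \<in> \<Union>C"
  proof (rule ccontr)
    assume "v \<notin> \<Union>C"
    then have "C \<subseteq> F" using C(1) by auto
    then show False using F(1) C(2) unfolding acyclic_edges_def by blast
  qed
  have deg: "degree C w = 2" if "w \<in> \<Union>C" for w using C(2) that unfolding is_cycle_def by blast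
  have "{e \<in> C. v \<in> e} \<noteq> {}" using vC by blast
  then obtain e1 where e1: "e1 \<in> C" "v \<in> e1" by blast
  then have "e1 \<in> ?N" using C(1) F(4) by blast
  then obtain u where u: "u \<in> U" "e1 = {v, u}" by blast
  define W where "W = {w \<in> \<Union>C - {v}. g w = g u}"
  define K where "K = {e \<in> C. e \<subseteq> W}"
  have "finite (\<Union>C)" using fC card2 by (metis card.infinite finite_Union zero_neq_numeral)
  then have fW: "finite W" by (rule rev_finite_subset) (auto simp: W_def)
  have uW: "u \<in> W" using u e1 U(2) unfolding W_def by auto
  have sub: "e \<subseteq> W" if e: "e \<in> C" "w \<in> e" "w \<in> W" "v \<notin> e" for e w
  proof -
    have "e \<in> F" using e C(1) by auto
    obtain x y where xy: "e = {x, y}" using card2[OF e(1)] by (meson card_2_iff)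
    have "g x = g y" using g(1) \<open>e \<in> F\<close> xy by blast
    then show ?thesis using e xy unfolding W_def by auto
  qed
  have degK: "degree K w = (if w = u then 1 else 2)" if w: "w \<in> W" for w
  proof (cases "w = u")
    case True
    have "{e \<in> C. u \<in> e} = insert e1 {e \<in> K. u \<in> e}"
    proof
      show "insert e1 {e \<in> K. u \<in> e} \<subseteq> {e \<in> C. u \<in> e}" using e1 u unfolding K_def by auto
      show "{e \<in> C. u \<in> e} \<subseteq> insert e1 {e \<in> K. u \<in> e}"
      proof
        fix e assume e: "e \<in> {e \<in> C. u \<in> e}"
        show "e \<in> insert e1 {e \<in> K. u \<in> e}"
        proof (cases "v \<in> e")
          case True
          then have "e = {v, u}" using e C(1) F(4) U(2) u(1) by auto
          then show ?thesis using u by simp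
        next
          case False
          then show ?thesis using e sub[of e u] uW unfolding K_def by auto
        qed
      qed
    qed
    moreover have "e1 \<notin> K" using e1 unfolding K_def W_def by auto
    moreover have "degree C u = 2" using deg uW unfolding W_def by blast
    moreover have "finite K" using fC unfolding K_def by simp
    ultimately show ?thesis using True unfolding degree_def by simp
  next
    case False
    have "v \<notin> e" if "e \<in> C" "w \<in> e" for e
    proof
      assume "v \<in> e"
      then have "e \<in> ?N" using that C(1) F(4) by blast
      then obtain u' where "u' \<in> U" "e = {v, u'}" by blast
      moreover from this have "w = u'" using that w unfolding W_def by auto
      ultimately show False using g(2) u(1) w False unfolding W_def inj_on_def by auto
    qed
    then have "{e \<in> C. w \<in> e} = {e \<in> K. w \<in> e}" using sub w unfolding K_def by blast
    moreover have "degree C w = 2" using deg w unfolding W_def by blast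
    ultimately show ?thesis using False unfolding degree_def by simp
  qed
  have "(\<Sum>w\<in>W. degree K w) = 2 * card K"
    by (rule handshake) (use fW fC card2 in \<open>auto simp: K_def\<close>)
  moreover have "(\<Sum>w\<in>W. degree K w) = 1 + (\<Sum>w\<in>W - {u}. 2)"
    using fW uW degK by (simp add: sum.remove)
  ultimately have "1 + 2 * card (W - {u}) = 2 * card K" by simp
  then show False by presburger
qed

text \<open>An edge carries the label Tr a if it is a tree edge, where a names the component of the forest built so
  far that contains it; Cy and Ma mark the 2-regular subgraph and the matching. In a decomposition of a
  cubic graph the three edges at a vertex form one of the three patterns of ok_star.\<close>

datatype lab = Tr nat | Cy | Ma

fun relabel :: "(nat \<Rightarrow> nat) \<Rightarrow> lab \<Rightarrow> lab" where
  "relabel h (Tr a) = Tr (h a)"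
| "relabel h Cy = Cy"
| "relabel h Ma = Ma"

definition ok_star :: "nat \<Rightarrow> lab multiset \<Rightarrow> bool" where
  "ok_star a L \<longleftrightarrow> L = {#Tr a, Tr a, Tr a#} \<or> L = {#Tr a, Tr a, Ma#} \<or> L = {#Tr a, Cy, Cy#}"

lemma ok_star_relabel: "ok_star a L \<Longrightarrow> ok_star (h a) (image_mset (relabel h) L)"
  unfolding ok_star_def by auto

lemma ok_star_Tr: "ok_star a L \<Longrightarrow> Tr b \<in># L \<longleftrightarrow> b = a"
  unfolding ok_star_def by auto

lemma relabel_Tr_iff: "relabel h x = Tr b \<longleftrightarrow> (\<exists>a. x = Tr a \<and> b = h a)"
  by (cases x) auto

text \<open>The renaming caused by one new vertex: the components it touches, \<open>K\<close>, fuse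
  into one called \<open>m\<close>. It is the identity if the vertex touches none, or only
  \<open>m\<close>.\<close>

definition merge :: "nat set \<Rightarrow> nat \<Rightarrow> nat \<Rightarrow> nat" where
  "merge K m a = (if a \<in> K then m else a)"

lemma relabel_merge_id: "K \<subseteq> {m} \<Longrightarrow> map (relabel (merge K m)) t = t"
proof (rule map_idI)
  fix x assume "K \<subseteq> {m}"
  then show "relabel (merge K m) x = x" by (cases x) (auto simp: merge_def)
qed

lemma relabel_merge_pair: "relabel (merge {a, b} a) = relabel (\<lambda>x. if x = b then a else x)"
  by (rule ext, rename_tac x, case_tac x) (auto simp: merge_def)

section \<open>Cuts and edge labellings of a cubic graph\<close>

locale cubic_graph =
  fixes V :: "'a set" and E :: "'a set set"
  assumes simple: "simple_graph V E" and cubic: "cubic V E"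
begin

definition inc :: "'a \<Rightarrow> 'a set set" where "inc v = {e \<in> E. v \<in> e}"

definition cut :: "'a set \<Rightarrow> 'a set set" where "cut A = {e \<in> E. e \<inter> A \<noteq> {} \<and> \<not> e \<subseteq> A}"

definition nb :: "'a \<Rightarrow> 'a set" where "nb v = {w. {v, w} \<in> E}"

lemma finite_V: "finite V" using simple unfolding simple_graph_def by blast

lemma edge_sub: "e \<in> E \<Longrightarrow> e \<subseteq> V" using simple unfolding simple_graph_def by blast

lemma edge_card: "e \<in> E \<Longrightarrow> card e = 2" using simple unfolding simple_graph_def by blast

lemma edgeE: assumes "e \<in> E" obtains x y where "e = {x, y}" "x \<noteq> y" "x \<in> V" "y \<in> V"
  using edge_card[OF assms] edge_sub[OF assms] by (auto simp: card_2_iff)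

lemma finite_E: "finite E"
  using finite_V edge_sub by (meson PowI finite_Pow_iff finite_subset subsetI)

lemma finite_inc [simp]: "finite (inc v)" using finite_E unfolding inc_def by simp

lemma finite_cut [simp]: "finite (cut A)" using finite_E unfolding cut_def by simp

lemma card_inc: "v \<in> V \<Longrightarrow> card (inc v) = 3"
  using cubic unfolding cubic_def degree_def inc_def by blast

lemma nb_sym: "w \<in> nb v \<longleftrightarrow> v \<in> nb w" unfolding nb_def by (simp add: insert_commute)

lemma nb_irrefl: "v \<notin> nb v"
proof
  assume "v \<in> nb v"
  then have "card {v, v} = 2" using edge_card unfolding nb_def by blast
  then show False by simp
qed

lemma nb_V: "nb v \<subseteq> V" using edge_sub unfolding nb_def by blast

lemma finite_nb [simp]: "finite (nb v)" using finite_subset[OF nb_V finite_V] .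

lemma inc_nb: "inc v = (\<lambda>w. {v, w}) ` nb v"
proof
  show "inc v \<subseteq> (\<lambda>w. {v, w}) ` nb v"
  proof
    fix e assume "e \<in> inc v"
    then have e: "e \<in> E" "v \<in> e" unfolding inc_def by auto
    from e(1) obtain x y where xy: "e = {x, y}" by (rule edgeE)
    then have "e = {v, x} \<or> e = {v, y}" using e by auto
    then show "e \<in> (\<lambda>w. {v, w}) ` nb v" using e unfolding nb_def by auto
  qed
qed (auto simp: inc_def nb_def)

lemma inj_star: "inj_on (\<lambda>w. {v, w}) B"
  by (auto simp: inj_on_def doubleton_eq_iff)

lemma card_nb: "v \<in> V \<Longrightarrow> card (nb v) = 3"
  using card_inc[of v] unfolding inc_nb by (simp add: card_image inj_star)

lemma cut_insert:
  assumes "v \<notin> A"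
  shows "cut (insert v A) = (cut A - inc v) \<union> (inc v - cut A)"
proof (intro set_eqI)
  fix e
  show "e \<in> cut (insert v A) \<longleftrightarrow> e \<in> (cut A - inc v) \<union> (inc v - cut A)"
  proof (cases "e \<in> E")
    case True
    then obtain x y where "e = {x, y}" "x \<noteq> y" by (rule edgeE)
    then show ?thesis using assms True unfolding cut_def inc_def by auto
  qed (auto simp: cut_def inc_def)
qed

lemma cut_inc:
  assumes "v \<notin> A"
  shows "cut A \<inter> inc v = (\<lambda>w. {v, w}) ` (nb v \<inter> A)"
  using assms unfolding inc_nb by (auto simp: cut_def nb_def)

text \<open>At a vertex whose star satisfies \<open>ok_star\<close> exactly one name occurs, so the
  set is a singleton that identifies the component of \<open>v\<close>.\<close>

definition cols :: "('a set \<Rightarrow> lab) \<Rightarrow> 'a \<Rightarrow> nat set" where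
  "cols f v = {a. \<exists>e\<in>inc v. f e = Tr a}"

definition inner_tree :: "'a set \<Rightarrow> ('a set \<Rightarrow> lab) \<Rightarrow> 'a set set" where
  "inner_tree A f = {e \<in> E. e \<subseteq> A \<and> (\<exists>a. f e = Tr a)}"

text \<open>Partial solutions: all edges meeting A are labelled, and f is arbitrary on the other edges.\<close>

definition sol :: "'a set \<Rightarrow> ('a set \<Rightarrow> lab) \<Rightarrow> bool" where
  "sol A f \<longleftrightarrow>
     (\<forall>v\<in>A. \<exists>a. ok_star a (image_mset f (mset_set (inc v)))) \<and>
     (\<forall>u\<in>A. \<forall>w\<in>A. cols f u \<inter> cols f w \<noteq> {} \<longrightarrow> (\<lambda>x y. {x, y} \<in> inner_tree A f)\<^sup>*\<^sup>* u w) \<and>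
     acyclic_edges (inner_tree A f)"

lemma ok_star_cols: "ok_star a (image_mset f (mset_set (inc v))) \<Longrightarrow> cols f v = {a}"
  unfolding cols_def using ok_star_Tr[of a "image_mset f (mset_set (inc v))"] by (auto simp: image_iff eq_commute)

lemma conn_sym: "(\<lambda>x y. {x, y} \<in> F)\<^sup>*\<^sup>* u w \<Longrightarrow> (\<lambda>x y. {x, y} \<in> F)\<^sup>*\<^sup>* w u"
  by (rule sympD[OF symp_rtranclp]) (auto simp: symp_def insert_commute)

lemma conn_mono: "F \<subseteq> G \<Longrightarrow> (\<lambda>x y. {x, y} \<in> F)\<^sup>*\<^sup>* u w \<Longrightarrow> (\<lambda>x y. {x, y} \<in> G)\<^sup>*\<^sup>* u w"
  by (erule rtranclp_mono[THEN predicate2D, rotated]) auto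

text \<open>\<open>K\<close> collects the components that \<open>v\<close> touches by tree edges. By
  \<open>inj\<close> there is at most one such edge into each, so no cycle arises; the assumption on
  \<open>m\<close> keeps the fused component apart from the untouched ones. Labels of the new edges
  at \<open>v\<close> are free subject to \<open>ok_star\<close>.\<close>

lemma sol_insert:
  assumes A: "A \<subseteq> V" "v \<in> V" "v \<notin> A" and f: "sol A f"
    and K: "K = {a. \<exists>e \<in> cut A \<inter> inc v. f e = Tr a}"
    and inj: "\<And>e e' a. e \<in> cut A \<inter> inc v \<Longrightarrow> e' \<in> cut A \<inter> inc v \<Longrightarrow> f e = Tr a \<Longrightarrow> f e' = Tr a \<Longrightarrow> e = e'"
    and m: "m \<in> K \<or> (\<forall>u\<in>A. m \<notin> cols f u)"
    and f': "\<And>e. e \<in> E \<Longrightarrow> e \<inter> A \<noteq> {} \<Longrightarrow> f' e = relabel (merge K m) (f e)"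
    and okv: "ok_star m (image_mset f' (mset_set (inc v)))"
  shows "sol (insert v A) f'"
    and "u \<in> A \<Longrightarrow> cols f' u = merge K m ` cols f u"
    and "cols f' v = {m}"
proof -
  let ?h = "merge K m" and ?B = "insert v A"
  have f'inc: "f' e = relabel ?h (f e)" if "u \<in> A" "e \<in> inc u" for u e
    using f' that unfolding inc_def by blast
  have okA: "\<exists>a. ok_star a (image_mset f (mset_set (inc u)))" if "u \<in> A" for u
    using f that unfolding sol_def by blast
  show colsA: "cols f' u = ?h ` cols f u" if "u \<in> A" for u
    unfolding cols_def using f'inc[OF that] by (auto simp: relabel_Tr_iff)
  show colsv: "cols f' v = {m}" using okv by (rule ok_star_cols)
  define X where "X = {w \<in> nb v \<inter> A. \<exists>a. f {v, w} = Tr a}"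
  have tree: "inner_tree ?B f' = inner_tree A f \<union> (\<lambda>w. {v, w}) ` X"
  proof (intro set_eqI)
    fix e
    show "e \<in> inner_tree ?B f' \<longleftrightarrow> e \<in> inner_tree A f \<union> (\<lambda>w. {v, w}) ` X"
    proof (cases "e \<in> E")
      case True
      then obtain x y where xy: "e = {x, y}" "x \<noteq> y" by (rule edgeE)
      have "(\<exists>a. f' e = Tr a) \<longleftrightarrow> (\<exists>a. f e = Tr a)" if "e \<inter> A \<noteq> {}"
        using f'[OF True that] by (auto simp: relabel_Tr_iff)
      then show ?thesis using True xy A(3) unfolding inner_tree_def X_def nb_def
        by (auto simp: insert_commute doubleton_eq_iff image_iff)
    qed (auto simp: inner_tree_def X_def nb_def)
  qed
  have X_cut: "{v, w} \<in> cut A \<inter> inc v" if "w \<in> nb v \<inter> A" for w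
    using that cut_inc[OF A(3)] by auto
  have tov: "(\<lambda>x y. {x, y} \<in> inner_tree ?B f')\<^sup>*\<^sup>* u v" if u: "u \<in> A" "a \<in> cols f u" "a \<in> K" for u a
  proof -
    obtain e where e: "e \<in> cut A \<inter> inc v" "f e = Tr a" using u(3) K by blast
    then obtain w where w: "w \<in> nb v \<inter> A" "e = {v, w}" using cut_inc[OF A(3)] by auto
    have "e \<in> inc w" using w unfolding inc_def nb_def by auto
    then have "a \<in> cols f w" using e unfolding cols_def by auto
    then have "(\<lambda>x y. {x, y} \<in> inner_tree A f)\<^sup>*\<^sup>* u w"
      using f u w unfolding sol_def by blast
    then have "(\<lambda>x y. {x, y} \<in> inner_tree ?B f')\<^sup>*\<^sup>* u w"
      by (rule conn_mono[rotated]) (use tree in blast)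
    moreover have "{w, v} \<in> inner_tree ?B f'"
      using w e unfolding tree X_def by (auto simp: insert_commute)
    ultimately show ?thesis by (rule rtranclp.rtrancl_into_rtrancl)
  qed
  have inK: "a \<in> K" if "u \<in> A" "a \<in> cols f u" "?h a = m" for u a
    using that m unfolding merge_def by (auto split: if_splits)
  have conn: "(\<lambda>x y. {x, y} \<in> inner_tree ?B f')\<^sup>*\<^sup>* u w"
    if uw: "u \<in> ?B" "w \<in> ?B" "cols f' u \<inter> cols f' w \<noteq> {}" for u w
  proof -
    have v: "(\<lambda>x y. {x, y} \<in> inner_tree ?B f')\<^sup>*\<^sup>* u v" if um: "u \<in> ?B" "m \<in> cols f' u" for u
    proof (cases "u = v")
      case False
      then have "u \<in> A" using um by simp
      then obtain a where "a \<in> cols f u" "?h a = m" using colsA[of u] um(2) by auto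
      then show ?thesis using tov inK \<open>u \<in> A\<close> by blast
    qed simp
    show ?thesis
    proof (cases "m \<in> cols f' u \<inter> cols f' w")
      case True
      have "(\<lambda>x y. {x, y} \<in> inner_tree ?B f')\<^sup>*\<^sup>* u v" using v[of u] uw True by blast
      also have "(\<lambda>x y. {x, y} \<in> inner_tree ?B f')\<^sup>*\<^sup>* v w"
        by (rule conn_sym) (use v[of w] uw True in blast)
      finally show ?thesis .
    next
      case False
      then obtain b where b: "b \<in> cols f' u \<inter> cols f' w" "b \<noteq> m" using uw(3) by blast
      then have uA: "u \<in> A" "w \<in> A" using uw colsv by auto
      then obtain a a' where a: "a \<in> cols f u" "b = ?h a" "a' \<in> cols f w" "b = ?h a'"
        using b colsA by auto
      \<comment> \<open>A name other than \<open>m\<close> has only itself as preimage, so the two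
        vertices already shared a component.\<close>
      then have "a = a'" using b(2) unfolding merge_def by (auto split: if_splits)
      then have "(\<lambda>x y. {x, y} \<in> inner_tree A f)\<^sup>*\<^sup>* u w"
        using f uA a unfolding sol_def by blast
      then show ?thesis by (rule conn_mono[rotated]) (use tree in blast)
    qed
  qed
  have ac: "acyclic_edges (inner_tree ?B f')"
    unfolding tree
  \<comment> \<open>\<open>g\<close> names the component of a vertex. It is constant along forest
    edges, since the name on an edge occurs in the stars of both ends, and injective on the ends of
    the new star by \<open>inj\<close>.\<close>
  proof (rule acyclic_edges_add_star[where g = "\<lambda>w. THE a. a \<in> cols f w"])
    show "acyclic_edges (inner_tree A f)" using f unfolding sol_def by blast
    show "finite (inner_tree A f)" using finite_E unfolding inner_tree_def by simp
    show "card e = 2" if "e \<in> inner_tree A f" for e using that edge_card unfolding inner_tree_def by blast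
    show "v \<notin> \<Union> (inner_tree A f)" using A(3) unfolding inner_tree_def by blast
    show "finite X" unfolding X_def by simp
    show "v \<notin> X" using A(3) unfolding X_def by blast
    have the: "(THE a. a \<in> cols f w) = b" if w: "w \<in> A" "b \<in> cols f w" for w b
    proof -
      obtain a where "cols f w = {a}" using okA[OF w(1)] ok_star_cols by blast
      then show ?thesis using w by auto
    qed
    show "(THE a. a \<in> cols f x) = (THE a. a \<in> cols f y)" if xy: "{x, y} \<in> inner_tree A f" for x y
    proof -
      obtain a where "f {x, y} = Tr a" using xy unfolding inner_tree_def by blast
      then have "a \<in> cols f x" "a \<in> cols f y" "x \<in> A" "y \<in> A"
        using xy unfolding inner_tree_def cols_def inc_def by auto
      then show ?thesis using the by metis
    qed
    show "inj_on (\<lambda>w. THE a. a \<in> cols f w) X"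
    proof (rule inj_onI)
      fix x y assume xy: "x \<in> X" "y \<in> X" "(THE a. a \<in> cols f x) = (THE a. a \<in> cols f y)"
      obtain a b where ab: "f {v, x} = Tr a" "f {v, y} = Tr b" using xy unfolding X_def by blast
      have "{v, x} \<in> inc x" "{v, y} \<in> inc y" using xy unfolding X_def nb_def inc_def by auto
      then have "a \<in> cols f x" "b \<in> cols f y" using ab unfolding cols_def by auto
      then have "a = b" using the xy unfolding X_def by auto
      then have "{v, x} = {v, y}"
        using ab inj[OF X_cut X_cut] xy unfolding X_def by blast
      then show "x = y" by (auto simp: doubleton_eq_iff)
    qed
  qed
  have "\<exists>a. ok_star a (image_mset f' (mset_set (inc u)))" if "u \<in> ?B" for u
  proof (cases "u = v")
    case False
    then have uA: "u \<in> A" using that by simp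
    obtain a where "ok_star a (image_mset f (mset_set (inc u)))" using okA[OF uA] by blast
    then have "ok_star (?h a) (image_mset (relabel ?h) (image_mset f (mset_set (inc u))))"
      by (rule ok_star_relabel)
    also have "image_mset (relabel ?h) (image_mset f (mset_set (inc u))) = image_mset f' (mset_set (inc u))"
      unfolding multiset.map_comp by (rule image_mset_cong) (simp add: f'inc[OF uA])
    finally show ?thesis by blast
  qed (use okv in blast)
  then show "sol ?B f'" using conn ac unfolding sol_def by blast
qed

text \<open>A single name everywhere makes the tree edges connected. The rest can be read off the
  stars: \<open>ok_star\<close> allows \<open>Cy\<close> zero or two times and \<open>Ma\<close> at
  most once.\<close>

lemma sol_decomposition:
  assumes f: "sol V f" and m: "\<And>u. u \<in> V \<Longrightarrow> cols f u = {m}"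
  shows "three_decomposition V E"
proof -
  define C where "C = {e \<in> E. f e = Cy}"
  define M where "M = {e \<in> E. f e = Ma}"
  let ?T = "inner_tree V f"
  have tree: "?T = {e \<in> E. \<exists>a. f e = Tr a}" using edge_sub unfolding inner_tree_def by blast
  have cnt: "card {e \<in> E. v \<in> e \<and> f e = l} = count (image_mset f (mset_set (inc v))) l" for v l
  proof -
    have "count (image_mset f (mset_set (inc v))) l = card (f -` {l} \<inter> inc v)"
      by (simp add: count_image_mset)
    moreover have "f -` {l} \<inter> inc v = {e \<in> E. v \<in> e \<and> f e = l}" unfolding inc_def by auto
    ultimately show ?thesis by simp
  qed
  have ok: "\<exists>a. ok_star a (image_mset f (mset_set (inc v)))" if "v \<in> V" for v
    using f that unfolding sol_def by blast
  have "spanning_tree V E ?T"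
    using f m unfolding spanning_tree_def sol_def connected_on_def by (auto simp: tree)
  moreover have "two_regular_sub E C"
    unfolding two_regular_sub_def
  proof (intro conjI ballI)
    fix v assume "v \<in> \<Union> C"
    then obtain e where e: "e \<in> E" "f e = Cy" "v \<in> e" unfolding C_def by blast
    then have vV: "v \<in> V" using edge_sub by blast
    have "degree C v = card {e \<in> E. v \<in> e \<and> f e = Cy}"
      unfolding degree_def C_def by (rule arg_cong[where f = card]) auto
    then have d: "degree C v = count (image_mset f (mset_set (inc v))) Cy" using cnt by simp
    define L where "L = image_mset f (mset_set (inc v))"
    have "Cy \<in># L" using e unfolding L_def inc_def by (auto simp: image_iff finite_E)
    moreover obtain a where "ok_star a L" using ok[OF vV] unfolding L_def by blast
    ultimately have "count L Cy = 2" unfolding ok_star_def by auto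
    then show "degree C v = 2" using d unfolding L_def by simp
  qed (simp add: C_def)
  moreover have "matching E M"
    unfolding matching_def
  proof (intro conjI ballI impI)
    fix e e' assume e: "e \<in> M" "e' \<in> M" "e \<noteq> e'"
    show "e \<inter> e' = {}"
    proof (rule ccontr)
      assume "e \<inter> e' \<noteq> {}"
      then obtain v where v: "v \<in> e" "v \<in> e'" by blast
      then have vV: "v \<in> V" using e edge_sub unfolding M_def by blast
      have "{e, e'} \<subseteq> {e \<in> E. v \<in> e \<and> f e = Ma}" using e v unfolding M_def by auto
      then have "card {e, e'} \<le> card {e \<in> E. v \<in> e \<and> f e = Ma}"
        using finite_E by (intro card_mono) auto
      then have "2 \<le> count (image_mset f (mset_set (inc v))) Ma" using cnt e by simp
      then show False using ok[OF vV] unfolding ok_star_def by auto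
    qed
  qed (simp add: M_def)
  moreover have "?T \<union> C \<union> M = E"
  proof -
    have "e \<in> ?T \<union> C \<union> M" if "e \<in> E" for e
      using that by (cases "f e") (auto simp: tree C_def M_def)
    then show ?thesis by (auto simp: tree C_def M_def)
  qed
  moreover have "?T \<inter> C = {}" "?T \<inter> M = {}" "C \<inter> M = {}" unfolding tree C_def M_def by auto
  ultimately show ?thesis unfolding three_decomposition_def by blast
qed

end

subsection \<open>Types of fragments\<close>

fun fresh :: "lab list \<Rightarrow> nat" where
  "fresh [] = 0"
| "fresh (Tr a # r) = max (Suc a) (fresh r)"
| "fresh (Cy # r) = fresh r"
| "fresh (Ma # r) = fresh r"

lemma fresh: "Tr a \<in> set r \<Longrightarrow> a < fresh r"
  by (induction r rule: fresh.induct) auto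

text \<open>Adding a vertex that meets the fragment in one cut edge replaces the label of this edge by two new ones
  (split1); adding a vertex that meets it in two cut edges replaces their labels by one (join1). The
  list r holds the labels of the remaining cut edges. Options that would leave a tree component without
  a cut edge, or close a cycle, are dropped.\<close>

fun split1 :: "lab \<Rightarrow> lab list \<Rightarrow> (lab \<times> lab) list" where
  "split1 (Tr a) r = (Tr a, Tr a) # (Tr a, Ma) # (Ma, Tr a) # (if Tr a \<in> set r then [(Cy, Cy)] else [])"
| "split1 Ma r = (let n = fresh r in [(Tr n, Tr n)])"
| "split1 Cy r = (let n = fresh r in [(Tr n, Cy), (Cy, Tr n)])"

fun join1 :: "lab \<Rightarrow> lab \<Rightarrow> lab list \<Rightarrow> lab list list" where
  "join1 (Tr a) (Tr b) r = (if a = b then [] else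
     (let r' = map (relabel (\<lambda>x. if x = b then a else x)) r in
       (Tr a # r') # (if Tr a \<in> set r' then [Ma # r'] else [])))"
| "join1 (Tr a) Ma r = [Tr a # r]"
| "join1 Ma (Tr a) r = [Tr a # r]"
| "join1 (Tr a) Cy r = (if Tr a \<in> set r then [Cy # r] else [])"
| "join1 Cy (Tr a) r = (if Tr a \<in> set r then [Cy # r] else [])"
| "join1 Cy Cy r = [Tr (fresh r) # r]"
| "join1 Ma Ma r = []"
| "join1 Cy Ma r = []"
| "join1 Ma Cy r = []"

definition reord :: "nat list \<Rightarrow> 'b list \<Rightarrow> 'b list" where
  "reord p xs = map ((!) xs) p"

datatype move = Split | Join | Perm "nat list"

fun play :: "move \<Rightarrow> lab list \<Rightarrow> lab list list" where
  "play Split (s # r) = map (\<lambda>(p, q). p # q # r) (split1 s r)"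
| "play Split [] = []"
| "play Join (s # t # r) = join1 s t r"
| "play Join _ = []"
| "play (Perm p) t = [reord p t]"

fun plays :: "move list \<Rightarrow> lab list list \<Rightarrow> lab list list" where
  "plays [] ts = ts"
| "plays (m # ms) ts = plays ms (concat (map (play m) ts))"

text \<open>Equality of types up to renaming of the components; m collects the pairs of names already matched.\<close>

fun iso :: "(nat \<times> nat) list \<Rightarrow> lab list \<Rightarrow> lab list \<Rightarrow> bool" where
  "iso m [] [] = True"
| "iso m (Cy # z) (y # ys) = (case y of Cy \<Rightarrow> iso m z ys | _ \<Rightarrow> False)"
| "iso m (Ma # z) (y # ys) = (case y of Ma \<Rightarrow> iso m z ys | _ \<Rightarrow> False)"
| "iso m (Tr a # z) (y # ys) = (case y of Tr b \<Rightarrow>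
      list_all (\<lambda>(a', b'). (a = a') = (b = b')) m \<and> iso ((a, b) # m) z ys | _ \<Rightarrow> False)"
| "iso m (_ # _) [] = False"
| "iso m [] (_ # _) = False"

text \<open>\<open>m\<close> is the graph of a partial injection that the recursion extends, so the
  induction needs arbitrary \<open>m\<close>. Injectivity on the names used lets the renaming pass
  through \<open>sol\<close> without fusing components.\<close>

lemma iso_relabel:
  assumes "iso m z y" "\<And>a b a' b'. (a, b) \<in> set m \<Longrightarrow> (a', b') \<in> set m \<Longrightarrow> a = a' \<longleftrightarrow> b = b'"
  shows "\<exists>h. map (h \<circ> fst) m = map snd m \<and> inj_on h (fst ` set m \<union> {a. Tr a \<in> set z}) \<and> map (relabel h) z = y"
  using assms
proof (induction m z y rule: iso.induct)
  case (1 m)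
  define h where "h a = (SOME b. (a, b) \<in> set m)" for a
  have h: "h a = b" if ab: "(a, b) \<in> set m" for a b
  proof -
    have "(a, h a) \<in> set m" unfolding h_def using ab by (rule someI)
    then show ?thesis using 1(2)[OF _ ab] by blast
  qed
  have "map (h \<circ> fst) m = map snd m" using h by (simp add: case_prod_unfold)
  moreover have "inj_on h (fst ` set m)"
  proof (rule inj_onI)
    fix x y assume xy: "x \<in> fst ` set m" "y \<in> fst ` set m" "h x = h y"
    obtain b b' where b: "(x, b) \<in> set m" "(y, b') \<in> set m" using xy(1,2) by (auto elim!: imageE)
    show "x = y" using 1(2)[OF b] xy(3) h[OF b(1)] h[OF b(2)] by simp
  qed
  ultimately show ?case by (intro exI[of _ h]) simp
next
  case (4 m a z y ys)
  obtain b where y: "y = Tr b" and ab: "list_all (\<lambda>(a', b'). (a = a') = (b = b')) m"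
    and i: "iso ((a, b) # m) z ys" using 4(2) by (auto split: lab.splits)
  have "\<exists>h. map (h \<circ> fst) ((a, b) # m) = map snd ((a, b) # m) \<and>
      inj_on h (fst ` set ((a, b) # m) \<union> {a. Tr a \<in> set z}) \<and> map (relabel h) z = ys"
  proof (rule 4(1)[OF y i])
    fix c d c' d' assume cd: "(c, d) \<in> set ((a, b) # m)" "(c', d') \<in> set ((a, b) # m)"
    have ab': "(a = x) = (b = y)" if "(x, y) \<in> set m" for x y using ab that by (auto simp: list_all_iff)
    show "(c = c') = (d = d')" using cd ab'[of c d] ab'[of c' d'] 4(3)[of c d c' d'] by auto
  qed
  then obtain h where h0: "map (h \<circ> fst) ((a, b) # m) = map snd ((a, b) # m)"
    and h: "inj_on h (fst ` set ((a, b) # m) \<union> {a. Tr a \<in> set z})" "map (relabel h) z = ys" by (elim exE conjE)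
  have "fst ` set ((a, b) # m) \<union> {a. Tr a \<in> set z} = fst ` set m \<union> {a'. Tr a' \<in> set (Tr a # z)}" by auto
  then have "inj_on h (fst ` set m \<union> {a'. Tr a' \<in> set (Tr a # z)})" using h(1) by (simp only:)
  moreover have "map (relabel h) (Tr a # z) = y # ys" using h(2) h0 y by (simp only: list.map list.inject relabel.simps o_apply fst_conv snd_conv)
  moreover have "map (h \<circ> fst) m = map snd m" using h0 by (simp only: list.map list.inject)
  ultimately show ?case by (intro exI[of _ h] conjI)
next
  case (2 m z y ys)
  have "y = Cy" "iso m z ys" using 2(2) by (simp_all split: lab.splits)
  then show ?case using 2(1)[OF _ _ 2(3)] by simp
next
  case (3 m z y ys)
  have "y = Ma" "iso m z ys" using 3(2) by (simp_all split: lab.splits)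
  then show ?case using 3(1)[OF _ _ 3(3)] by simp
qed simp_all

text \<open>One-sided on purpose: the realised types \<open>zs\<close> may exceed \<open>Y\<close>,
  since further types only help.\<close>

definition covers :: "lab list list \<Rightarrow> lab list list \<Rightarrow> bool" where
  "covers zs Y = list_all (\<lambda>y. list_ex (\<lambda>z. iso [] z y) zs) Y"

section \<open>Realised types and the soundness of the moves\<close>

context cubic_graph begin

text \<open>The last conjunct says that every component of the forest is met by a tree edge of the cut.\<close>

definition realises :: "'a set \<Rightarrow> 'a set list \<Rightarrow> lab list \<Rightarrow> bool" where
  "realises A es t \<longleftrightarrow> (\<exists>f. sol A f \<and> t = map f es \<and> (\<forall>u\<in>A. \<forall>a\<in>cols f u. Tr a \<in> set t))"

definition realises_all :: "'a set \<Rightarrow> 'a set list \<Rightarrow> lab list list \<Rightarrow> bool" where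
  "realises_all A es ts \<longleftrightarrow> (\<forall>t\<in>set ts. realises A es t)"

lemma sol_relabel:
  assumes f: "sol A f" and inj: "inj_on h (\<Union>u\<in>A. cols f u)"
  shows "sol A (relabel h \<circ> f)" and "cols (relabel h \<circ> f) u = h ` cols f u"
proof -
  show c: "cols (relabel h \<circ> f) u = h ` cols f u" for u
    unfolding cols_def by (auto simp: relabel_Tr_iff)
  have t: "inner_tree A (relabel h \<circ> f) = inner_tree A f"
    unfolding inner_tree_def by (auto simp: relabel_Tr_iff)
  have "\<exists>a. ok_star a (image_mset (relabel h \<circ> f) (mset_set (inc v)))" if v: "v \<in> A" for v
  proof -
    obtain a where "ok_star a (image_mset f (mset_set (inc v)))" using f v unfolding sol_def by blast
    from ok_star_relabel[OF this] show ?thesis by (auto simp: multiset.map_comp)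
  qed
  moreover have "cols f u \<inter> cols f w \<noteq> {}" if "u \<in> A" "w \<in> A" "h ` cols f u \<inter> h ` cols f w \<noteq> {}" for u w
    using inj that unfolding inj_on_def by blast
  ultimately show "sol A (relabel h \<circ> f)" using f unfolding sol_def c t by blast
qed

lemma realises_iso:
  assumes "realises A es z" "iso [] z y"
  shows "realises A es y"
proof -
  obtain h where h: "inj_on h {a. Tr a \<in> set z}" "map (relabel h) z = y"
    using iso_relabel[OF assms(2)] by auto
  obtain f where f: "sol A f" "z = map f es" "\<forall>u\<in>A. \<forall>a\<in>cols f u. Tr a \<in> set z"
    using assms(1) unfolding realises_def by blast
  have inj: "inj_on h (\<Union>u\<in>A. cols f u)" by (rule inj_on_subset[OF h(1)]) (use f(3) in auto)
  have "y = map (relabel h \<circ> f) es" using h(2) f(2) by simp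
  moreover have "\<forall>u\<in>A. \<forall>a\<in>cols (relabel h \<circ> f) u. Tr a \<in> set y"
  proof (intro ballI)
    fix u a assume "u \<in> A" "a \<in> cols (relabel h \<circ> f) u"
    then obtain b where "a = h b" "Tr b \<in> set z" using sol_relabel(2)[OF f(1) inj] f(3) by blast
    then have "relabel h (Tr b) \<in> set y" "relabel h (Tr b) = Tr a" using h(2) by (force, simp)
    then show "Tr a \<in> set y" by simp
  qed
  ultimately show ?thesis using sol_relabel(1)[OF f(1) inj] unfolding realises_def by blast
qed

text \<open>The common core of both moves: the edges \<open>xs\<close> lead from \<open>v\<close>
  back into \<open>A\<close> and leave the cut, the edges \<open>ys\<close> enter it with labels
  \<open>ty\<close>, and \<open>rs\<close> stays up to the fusion of components. The hypothesis
  \<open>ex\<close> keeps the component of \<open>v\<close> visible in the new cut.\<close>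

lemma realises_add:
  assumes A: "A \<subseteq> V" "v \<in> V" "v \<notin> A"
    and re: "realises A (xs @ rs) (tx @ tr)" and len: "length xs = length tx" "length ys = length ty"
    and cutA: "set (xs @ rs) = cut A" and incv: "inc v = set xs \<union> set ys"
    and dist: "distinct (xs @ ys)" "set ys \<inter> cut A = {}" "set xs \<inter> set rs = {}"
    and K: "K = {a. Tr a \<in> set tx}"
    and inj: "\<And>i j a. i < length tx \<Longrightarrow> j < length tx \<Longrightarrow> tx ! i = Tr a \<Longrightarrow> tx ! j = Tr a \<Longrightarrow> i = j"
    and m: "m \<in> K \<or> Tr m \<notin> set (tx @ tr)"
    and tr': "tr' = map (relabel (merge K m)) tr"
    and okv: "ok_star m (mset (map (relabel (merge K m)) tx @ ty))"
    and ex: "Tr m \<in> set (ty @ tr')"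
  shows "realises (insert v A) (ys @ rs) (ty @ tr')"
proof -
  let ?h = "merge K m"
  obtain f where f: "sol A f" "tx @ tr = map f (xs @ rs)" "\<forall>u\<in>A. \<forall>a\<in>cols f u. Tr a \<in> set (tx @ tr)"
    using re unfolding realises_def by blast
  have tx: "tx = map f xs" "tr = map f rs" using f(2) len(1) by auto
  define f' where "f' e = (case map_of (zip ys ty) e of Some l \<Rightarrow> l | None \<Rightarrow> relabel ?h (f e))" for e
  have f'ys: "map f' ys = ty"
    using len(2) dist(1) unfolding f'_def by (intro nth_equalityI) (auto simp: map_of_zip_nth)
  have f'o: "f' e = relabel ?h (f e)" if "e \<notin> set ys" for e
  proof -
    have "map_of (zip ys ty) e = None" using that by (auto simp: map_of_eq_None_iff dest: set_zip_leftD)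
    then show ?thesis unfolding f'_def by simp
  qed
  have ci: "cut A \<inter> inc v = set xs" using cutA incv dist by auto
  have Kf: "K = {a. \<exists>e \<in> cut A \<inter> inc v. f e = Tr a}" unfolding ci K tx by (auto simp: image_iff eq_commute)
  have mf: "m \<in> K \<or> (\<forall>u\<in>A. m \<notin> cols f u)" using m f(3) by blast
  have injf: "e = e'" if e: "e \<in> cut A \<inter> inc v" "e' \<in> cut A \<inter> inc v" "f e = Tr a" "f e' = Tr a" for e e' a
  proof -
    obtain i j where "i < length xs" "e = xs ! i" "j < length xs" "e' = xs ! j"
      using e(1,2) unfolding ci by (auto simp: in_set_conv_nth)
    then show ?thesis using inj[of i j a] e(3,4) tx(1) by simp
  qed
  have f'A: "f' e = relabel ?h (f e)" if e: "e \<in> E" "e \<inter> A \<noteq> {}" for e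
  proof (rule f'o, rule notI)
    assume "e \<in> set ys"
    then have "e \<in> inc v" "e \<notin> cut A" using incv dist by auto
    then show False using e A(3) unfolding inc_def cut_def by auto
  qed
  have xs': "map f' xs = map (relabel ?h) tx" unfolding tx using dist(1) f'o by auto
  have "rs \<in> lists (- set ys)" using cutA dist(2) by auto
  then have rs': "map f' rs = tr'" unfolding tx tr' using f'o by auto
  have "mset_set (inc v) = mset (xs @ ys)" unfolding incv using dist(1) by (metis mset_set_set set_append)
  then have okv': "ok_star m (image_mset f' (mset_set (inc v)))"
    using okv f'ys xs' by (metis map_append mset_map)
  have si: "sol (insert v A) f'" by (rule sol_insert(1)[OF A f(1) Kf injf mf f'A okv'])
  have si2: "cols f' u = ?h ` cols f u" if "u \<in> A" for u
    by (rule sol_insert(2)[OF A f(1) Kf injf mf f'A okv' that])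
  have si3: "cols f' v = {m}" by (rule sol_insert(3)[OF A f(1) Kf injf mf f'A okv'])
  have "map f' (ys @ rs) = ty @ tr'" using f'ys rs' by simp
  moreover have "Tr a \<in> set (ty @ tr')" if u: "u \<in> insert v A" "a \<in> cols f' u" for u a
  proof (cases "a = m")
    case False
    then have uA: "u \<in> A" using u si3 by auto
    then obtain b where b: "b \<in> cols f u" "a = ?h b" using si2 u(2) by blast
    then have "b = a" "b \<notin> K" using False unfolding merge_def by (auto split: if_splits)
    \<comment> \<open>A component that \<open>v\<close> does not touch must show itself on an edge
      of \<open>rs\<close>, and its name survives the fusion.\<close>
    then have "Tr b \<in> set tr" using f(3) uA b(1) K by auto
    then have "relabel ?h (Tr b) \<in> set tr'" unfolding tr' set_map by (rule imageI)
    then show ?thesis using \<open>b = a\<close> \<open>b \<notin> K\<close> by (simp add: merge_def)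
  qed (use ex in simp)
  ultimately show ?thesis using si unfolding realises_def by metis
qed

lemma realises_split:
  assumes A: "A \<subseteq> V" "v \<in> V" "v \<notin> A"
    and re: "realises A (x # rs) (s # t)"
    and g: "set (x # rs) = cut A" "x \<notin> set rs" "inc v = {x, y, z}" "distinct [x, y, z]" "y \<notin> cut A" "z \<notin> cut A"
    and pq: "(p, q) \<in> set (split1 s t)"
  shows "realises (insert v A) (y # z # rs) (p # q # t)"
proof -
  \<comment> \<open>With one edge back into \<open>A\<close> at most one component is touched, so
    nothing needs renaming; this is why \<open>K\<close> lies inside \<open>{m}\<close>.\<close>
  have main: "realises (insert v A) ([y, z] @ rs) ([p, q] @ t)"
    if K: "K = {a. Tr a \<in> set [s]}" "K \<subseteq> {m}" and m: "m \<in> K \<or> Tr m \<notin> set ([s] @ t)"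
      and ok: "ok_star m (mset ([s] @ [p, q]))" "Tr m \<in> set ([p, q] @ t)" for K m
  proof (rule realises_add[OF A, where xs = "[x]" and rs = rs and tx = "[s]" and tr = t
        and ys = "[y, z]" and ty = "[p, q]" and m = m and K = K and tr' = t])
    show "ok_star m (mset (map (relabel (merge K m)) [s] @ [p, q]))"
      unfolding relabel_merge_id[OF K(2)] by (rule ok(1))
    show "t = map (relabel (merge K m)) t" by (simp add: relabel_merge_id[OF K(2)])
  qed (use re g K m ok in auto)
  show ?thesis
  proof (cases s)
    case (Tr a)
    show ?thesis using main[of "{a}" a] pq unfolding Tr by (auto simp: ok_star_def split: if_splits)
  next
    case Cy
    \<comment> \<open>The replaced label carries no name, so a name absent from \<open>t\<close> is
      absent from the whole type.\<close>
    have "Tr (fresh t) \<notin> set t" using fresh by blast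
    then show ?thesis using main[of "{}" "fresh t"] pq unfolding Cy by (auto simp: ok_star_def Let_def)
  next
    case Ma
    have "Tr (fresh t) \<notin> set t" using fresh by blast
    then show ?thesis using main[of "{}" "fresh t"] pq unfolding Ma by (auto simp: ok_star_def Let_def)
  qed
qed

lemma realises_join:
  assumes A: "A \<subseteq> V" "v \<in> V" "v \<notin> A"
    and re: "realises A (x # y # rs) (s # t # r)"
    and g: "set (x # y # rs) = cut A" "x \<notin> set rs" "y \<notin> set rs"
      "inc v = {x, y, z}" "distinct [x, y, z]" "z \<notin> cut A"
    and pq: "w \<in> set (join1 s t r)"
  shows "realises (insert v A) (z # rs) w"
proof -
  \<comment> \<open>\<open>st\<close> excludes two tree edges into the same component, which would
    close a cycle through \<open>v\<close>. A genuine fusion occurs only when both edges are tree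
    edges.\<close>
  have main: "realises (insert v A) ([z] @ rs) ([p] @ r')"
    if K: "K = {a. Tr a \<in> set [s, t]}" and st: "\<And>a. \<not> (s = Tr a \<and> t = Tr a)"
      and m: "m \<in> K \<or> Tr m \<notin> set ([s, t] @ r)"
      and ok: "ok_star m (mset (map (relabel (merge K m)) [s, t] @ [p]))" "Tr m \<in> set ([p] @ r')"
      and r': "r' = map (relabel (merge K m)) r" for K m p r'
  proof (rule realises_add[OF A, where xs = "[x, y]" and rs = rs and tx = "[s, t]" and tr = r
        and ys = "[z]" and ty = "[p]" and m = m and K = K and tr' = r'])
    show "i = j" if "i < length [s, t]" "j < length [s, t]" "[s, t] ! i = Tr a" "[s, t] ! j = Tr a" for i j a
      using that st[of a] by (auto simp: less_Suc_eq)
  qed (use re g that in auto)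
  have fr: "Tr (fresh r) \<notin> set r" using fresh by blast
  show ?thesis
  proof (cases s)
    case s: (Tr a)
    show ?thesis
    proof (cases t)
      case t: (Tr b)
      have ab: "a \<noteq> b" using pq unfolding s t by auto
      have K: "{c. Tr c \<in> set [s, t]} = {a, b}" unfolding s t by auto
      show ?thesis
        using main[of "{a, b}" a, OF K[symmetric] _ _ _ _ refl] pq ab unfolding s t relabel_merge_pair
        by (auto simp: ok_star_def Let_def split: if_splits)
    qed (use main[of "{a}" a] pq s in \<open>auto simp: relabel_merge_id ok_star_def merge_def split: if_splits\<close>)
  next
    case s: Cy
    show ?thesis
    proof (cases t)
      case t: (Tr b)
      show ?thesis using main[of "{b}" b] pq s t by (auto simp: relabel_merge_id ok_star_def merge_def split: if_splits)
    qed (use main[of "{}" "fresh r"] fr pq s in \<open>auto simp: relabel_merge_id ok_star_def merge_def\<close>)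
  next
    case s: Ma
    show ?thesis
    proof (cases t)
      case t: (Tr b)
      show ?thesis using main[of "{b}" b] pq s t by (auto simp: relabel_merge_id ok_star_def merge_def split: if_splits)
    qed (use pq s in auto)
  qed
qed

lemma realises_all_split:
  assumes "A \<subseteq> V" "v \<in> V" "v \<notin> A" "realises_all A (x # rs) ts"
    "set (x # rs) = cut A" "x \<notin> set rs" "inc v = {x, y, z}" "distinct [x, y, z]" "y \<notin> cut A" "z \<notin> cut A"
  shows "realises_all (insert v A) (y # z # rs) (concat (map (play Split) ts))"
  unfolding realises_all_def
proof
  fix w assume "w \<in> set (concat (map (play Split) ts))"
  then obtain t where t: "t \<in> set ts" "w \<in> set (play Split t)" by auto
  have "\<exists>s r. t = s # r" by (cases "(Split, t)" rule: play.cases) (use t(2) in auto)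
  then obtain s r where st: "t = s # r" by blast
  then obtain p q where "w = p # q # r" "(p, q) \<in> set (split1 s r)" using t by auto
  then show "realises (insert v A) (y # z # rs) w"
    using realises_split[OF assms(1-3) _ assms(5-10)] assms(4) t st unfolding realises_all_def by blast
qed

lemma realises_all_join:
  assumes "A \<subseteq> V" "v \<in> V" "v \<notin> A" "realises_all A (x # y # rs) ts"
    "set (x # y # rs) = cut A" "x \<notin> set rs" "y \<notin> set rs"
    "inc v = {x, y, z}" "distinct [x, y, z]" "z \<notin> cut A"
  shows "realises_all (insert v A) (z # rs) (concat (map (play Join) ts))"
  unfolding realises_all_def
proof
  fix w assume "w \<in> set (concat (map (play Join) ts))"
  then obtain t where t: "t \<in> set ts" "w \<in> set (play Join t)" by auto
  have "\<exists>s s' r. t = s # s' # r" by (cases "(Join, t)" rule: play.cases) (use t(2) in auto)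
  then obtain s s' r where st: "t = s # s' # r" by blast
  then show "realises (insert v A) (z # rs) w"
    using realises_join[OF assms(1-3) _ assms(5-10)] assms(4) t st unfolding realises_all_def by auto
qed

lemma realises_all_perm:
  assumes "realises_all A es ts" "set p = {..<length es}"
  shows "realises_all A (reord p es) (concat (map (play (Perm p)) ts))"
  unfolding realises_all_def
proof
  fix w assume "w \<in> set (concat (map (play (Perm p)) ts))"
  then obtain t where t: "t \<in> set ts" "w = reord p t" by auto
  then obtain f where f: "sol A f" "t = map f es" "\<forall>u\<in>A. \<forall>a\<in>cols f u. Tr a \<in> set t"
    using assms(1) unfolding realises_all_def realises_def by blast
  have "reord p t = map f (reord p es)" unfolding reord_def f(2) using assms(2) by auto
  moreover have "set (reord p t) = set t"
  proof -
    have "set t = (!) t ` {..<length t}" by (auto simp: set_conv_nth)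
    then show ?thesis unfolding reord_def using assms(2) f(2) by simp
  qed
  ultimately show "realises A (reord p es) w" using f t unfolding realises_def by metis
qed

lemma realises_all_covers:
  assumes "realises_all A es zs" "covers zs Y"
  shows "realises_all A es Y"
  using assms realises_iso unfolding realises_all_def covers_def list_all_iff list_ex_iff by blast

end

subsection \<open>From path decompositions to chains of small cuts\<close>

context cubic_graph begin

text \<open>Of the three edges at \<open>v\<close>, those into \<open>A\<close> leave the cut and
  the others enter it. The additive form avoids subtraction on naturals.\<close>

lemma card_cut_insert:
  assumes "v \<in> V" "v \<notin> A"
  shows "card (cut (insert v A)) + 2 * card (nb v \<inter> A) = card (cut A) + 3"
proof -
  have i: "card (cut A \<inter> inc v) = card (nb v \<inter> A)"
    unfolding cut_inc[OF assms(2)] by (rule card_image[OF inj_star])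
  have "card (cut A) = card (cut A - inc v) + card (cut A \<inter> inc v)"
    by (metis card_Diff_subset_Int card_mono finite_cut finite_Int inf_le1 le_add_diff_inverse2)
  moreover have "card (inc v) = card (inc v - cut A) + card (cut A \<inter> inc v)"
    by (metis card_Diff_subset_Int card_mono finite_inc finite_Int inf_commute inf_le1 le_add_diff_inverse2)
  moreover have "card (cut (insert v A)) = card (cut A - inc v) + card (inc v - cut A)"
    unfolding cut_insert[OF assms(2)] by (rule card_Un_disjoint) auto
  ultimately show ?thesis using card_inc[OF assms(1)] i by simp
qed

lemma cut_empty [simp]: "cut {} = {}"
  unfolding cut_def by simp

lemma cut_V [simp]: "cut V = {}"
  unfolding cut_def using edge_sub by blast

lemma cut_compl: "A \<subseteq> V \<Longrightarrow> cut (V - A) = cut A"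
  unfolding cut_def using edge_sub by blast

lemma finite_sub: "A \<subseteq> V \<Longrightarrow> finite A"
  using finite_V finite_subset by blast

text \<open>Each added vertex changes the size of the cut by an odd number.\<close>

lemma cut_parity:
  assumes "A \<subseteq> V"
  shows "even (card A + card (cut A))"
  using finite_sub[OF assms] assms
proof (induction A rule: finite_induct)
  case (insert v A)
  then have "card (cut (insert v A)) + 2 * card (nb v \<inter> A) = card (cut A) + 3"
    by (intro card_cut_insert) auto
  moreover have "even (card A + card (cut A))" using insert by simp
  ultimately show ?case using insert(1,2) by (simp; presburger)
qed simp

text \<open>The ends in \<open>A\<close> of at most two cut edges form a set \<open>S\<close> of at
  most two vertices separating the rest of \<open>A\<close> from the complement. A vertex of
  \<open>A\<close> off \<open>S\<close> is needed, so sets of size one and two are excluded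
  beforehand by counting.\<close>

lemma three_edge_connected:
  assumes con: "k_connected 3 V E" and A: "A \<subseteq> V" "A \<noteq> {}" "A \<noteq> V"
  shows "3 \<le> card (cut A)"
proof (rule ccontr)
  assume "\<not> 3 \<le> card (cut A)"
  then have small: "card (cut A) \<le> 2" by simp
  have fA: "finite A" using A(1) by (rule finite_sub)
  have "card A \<noteq> 1"
  proof
    assume "card A = 1"
    then obtain v where "A = {v}" by (rule card_1_singletonE)
    then show False using card_cut_insert[of v "{}"] A(1) small by simp
  qed
  moreover have "card A \<noteq> 2"
  proof
    assume "card A = 2"
    then obtain u w where uw: "A = {u, w}" "u \<noteq> w" by (auto simp: card_2_iff)
    have "card (nb u \<inter> {w}) \<le> card {w}" by (intro card_mono) auto
    then show False
      using card_cut_insert[of w "{}"] card_cut_insert[of u "{w}"] A(1) uw small by simp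
  qed
  moreover have "card A \<noteq> 0" using A(2) fA by simp
  ultimately have cA: "3 \<le> card A" by linarith
  define S where "S = (\<Union>e\<in>cut A. e \<inter> A)"
  have "card S \<le> (\<Sum>e\<in>cut A. card (e \<inter> A))" unfolding S_def by (rule card_UN_le) simp
  also have "\<dots> \<le> (\<Sum>e\<in>cut A. 1)"
  proof (rule sum_mono)
    fix e assume e: "e \<in> cut A"
    then have "e \<in> E" unfolding cut_def by simp
    then obtain x y where xy: "e = {x, y}" by (rule edgeE)
    then have "e \<inter> A \<subseteq> {x} \<or> e \<inter> A \<subseteq> {y}" using e unfolding cut_def by auto
    then show "card (e \<inter> A) \<le> 1" by (metis card_mono finite.emptyI finite.insertI is_singletonI is_singleton_altdef)
  qed
  also have "\<dots> \<le> 2" using small by simp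
  finally have cS: "card S \<le> 2" .
  have SA: "S \<subseteq> A" unfolding S_def by auto
  have "A - S \<noteq> {}"
  proof
    assume "A - S = {}"
    then have "A = S" using SA by auto
    then show False using cA cS by simp
  qed
  then obtain u where u: "u \<in> A" "u \<notin> S" by blast
  obtain w where w: "w \<in> V" "w \<notin> A" using A by blast
  have "connected_on (V - S) (induced_edges E (V - S))"
    using con SA A(1) cS unfolding k_connected_def by auto
  then have "(\<lambda>x y. {x, y} \<in> induced_edges E (V - S))\<^sup>*\<^sup>* u w"
    unfolding connected_on_def using u w A(1) SA by blast
  then have "w \<in> A - S"
  proof (induction rule: rtranclp_induct)
    case (step x y)
    then have e: "{x, y} \<in> E" "y \<notin> S" unfolding induced_edges_def by auto
    have "y \<in> A"
    proof (rule ccontr)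
      assume "y \<notin> A"
      then have "{x, y} \<in> cut A" using e step(3) unfolding cut_def by auto
      then show False using step(3) unfolding S_def by blast
    qed
    then show ?case using e by simp
  qed (use u in simp)
  then show False using w by simp
qed

text \<open>The inequality holds for the contribution of each single edge, whichever of its ends lie
  in \<open>A\<close> and \<open>B\<close>.\<close>

lemma cut_submodular: "card (cut (A \<inter> B)) + card (cut (A \<union> B)) \<le> card (cut A) + card (cut B)"
proof -
  have c: "card (cut D) = (\<Sum>e\<in>E. if e \<inter> D \<noteq> {} \<and> \<not> e \<subseteq> D then 1 else 0)" for D
    unfolding cut_def using finite_E by (simp add: sum.If_cases Int_def)
  show ?thesis
    unfolding c sum.distrib[symmetric]
  proof (rule sum_mono)
    fix e assume "e \<in> E"
    then obtain x y where e: "e = {x, y}" by (rule edgeE)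
    show "(if e \<inter> (A \<inter> B) \<noteq> {} \<and> \<not> e \<subseteq> A \<inter> B then 1 else 0) +
         (if e \<inter> (A \<union> B) \<noteq> {} \<and> \<not> e \<subseteq> A \<union> B then 1 else 0)
         \<le> (if e \<inter> A \<noteq> {} \<and> \<not> e \<subseteq> A then 1 else 0) + (if e \<inter> B \<noteq> {} \<and> \<not> e \<subseteq> B then 1 else (0::nat))"
      unfolding e by (cases "x \<in> A"; cases "y \<in> A"; cases "x \<in> B"; cases "y \<in> B") simp_all
  qed
qed

section \<open>Minimum cuts near a vertex separator\<close>

definition bd :: "'a set \<Rightarrow> 'a set" where
  "bd P = {v \<in> P. \<not> nb v \<subseteq> P}"

text \<open>Only boundary vertices of \<open>P\<close> may be dropped, so a candidate assigns each
  separator vertex to a side; minimality is over all these assignments at once.\<close>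

definition min_cut :: "'a set \<Rightarrow> 'a set \<Rightarrow> bool" where
  "min_cut P A \<longleftrightarrow> P - bd P \<subseteq> A \<and> A \<subseteq> P \<and>
     (\<forall>B. P - bd P \<subseteq> B \<longrightarrow> B \<subseteq> P \<longrightarrow> card (cut A) \<le> card (cut B))"

lemma min_cut_sub: "min_cut P A \<Longrightarrow> P - bd P \<subseteq> A" "min_cut P A \<Longrightarrow> A \<subseteq> P"
  unfolding min_cut_def by simp_all

lemma min_cut_le: "min_cut P A \<Longrightarrow> P - bd P \<subseteq> B \<Longrightarrow> B \<subseteq> P \<Longrightarrow> card (cut A) \<le> card (cut B)"
  unfolding min_cut_def by simp

lemma min_cut_exists: "\<exists>A. min_cut P A"
proof -
  let ?I = "\<lambda>A. P - bd P \<subseteq> A \<and> A \<subseteq> P"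
  have "?I P" by blast
  from arg_min_nat_lemma[of ?I, OF this, of "\<lambda>A. card (cut A)"]
  have "min_cut P (arg_min (\<lambda>A. card (cut A)) ?I)" unfolding min_cut_def by simp
  then show ?thesis by (rule exI)
qed

text \<open>By local minimality every vertex of the separator bd P has at most one edge in the cut.\<close>

lemma min_cut_card:
  assumes P: "P \<subseteq> V" and A: "min_cut P A"
  shows "card (cut A) \<le> card (bd P)"
proof -
  have fbd: "finite (bd P)" using finite_sub[OF P] unfolding bd_def by simp
  note AP = min_cut_sub[OF A] and le = min_cut_le[OF A]
  have one: "card (cut A \<inter> inc s) \<le> 1" if s: "s \<in> bd P" for s
  proof (cases "s \<in> A")
    case True
    have sV: "s \<in> V" "s \<in> P" using s P unfolding bd_def by auto
    have "card (cut A) \<le> card (cut (A - {s}))" by (rule le) (use AP s in auto)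
    moreover have "card (cut A) + 2 * card (nb s \<inter> (A - {s})) = card (cut (A - {s})) + 3"
      using card_cut_insert[of s "A - {s}"] sV True by (simp add: insert_absorb)
    ultimately have "2 \<le> card (nb s \<inter> (A - {s}))" by linarith
    also have "nb s \<inter> (A - {s}) = nb s \<inter> A" using nb_irrefl by auto
    finally have "card (nb s - A) \<le> 1" using card_nb[OF sV(1)] card_Diff_subset_Int[of "nb s" A] by simp
    moreover have "cut A \<inter> inc s \<subseteq> (\<lambda>w. {s, w}) ` (nb s - A)"
      using True unfolding inc_nb cut_def by auto
    ultimately show ?thesis
      by (meson card_image_le card_mono finite_Diff finite_imageI finite_nb le_trans)
  next
    case False
    have "card (cut A) \<le> card (cut (insert s A))" by (rule le) (use AP s in \<open>auto simp: bd_def\<close>)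
    then have "card (nb s \<inter> A) \<le> 1" using card_cut_insert[of s A] False s P unfolding bd_def by fastforce
    then show ?thesis unfolding cut_inc[OF False] using card_image[OF inj_star, of s "nb s \<inter> A"] by simp
  qed
  have "cut A \<subseteq> (\<Union>s\<in>bd P. cut A \<inter> inc s)"
  proof
    fix e assume e: "e \<in> cut A"
    then have "e \<in> E" unfolding cut_def by simp
    then obtain x y where "e = {x, y}" by (rule edgeE)
    then obtain x y where xy: "e = {x, y}" "x \<in> A" "y \<notin> A" using e unfolding cut_def by auto
    have "x \<in> bd P \<or> y \<in> bd P"
    proof (rule ccontr)
      assume n: "\<not> (x \<in> bd P \<or> y \<in> bd P)"
      have "y \<in> nb x" using xy \<open>e \<in> E\<close> unfolding nb_def by simp
      then have "y \<in> P" using n xy AP unfolding bd_def by auto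
      then show False using n xy AP by auto
    qed
    then show "e \<in> (\<Union>s\<in>bd P. cut A \<inter> inc s)" using e xy \<open>e \<in> E\<close> unfolding inc_def by auto
  qed
  then have "card (cut A) \<le> card (\<Union>s\<in>bd P. cut A \<inter> inc s)" by (rule card_mono[rotated]) (use fbd in auto)
  also have "\<dots> \<le> (\<Sum>s\<in>bd P. card (cut A \<inter> inc s))" by (rule card_UN_le[OF fbd])
  also have "\<dots> \<le> (\<Sum>s\<in>bd P. 1)" by (rule sum_mono) (rule one)
  finally show ?thesis by simp
qed

text \<open>Uncrossing: the interior of \<open>P\<close> lies in that of \<open>Q\<close>, so the
  intersection with a minimum cut \<open>B\<close> of \<open>Q\<close> competes with
  \<open>A\<close> for \<open>P\<close>. Submodularity then makes the union no worse than
  \<open>B\<close>, hence minimal for \<open>Q\<close>.\<close>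

lemma min_cut_extend:
  assumes "min_cut P A" "P \<subseteq> Q"
  shows "\<exists>B. min_cut Q B \<and> A \<subseteq> B"
proof -
  obtain B where B: "min_cut Q B" using min_cut_exists by blast
  have sub: "P - bd P \<subseteq> Q - bd Q" using assms(2) unfolding bd_def by auto
  note a = min_cut_sub[OF assms(1)] and b = min_cut_sub[OF B]
  have "card (cut A) \<le> card (cut (A \<inter> B))"
    by (rule min_cut_le[OF assms(1)]) (use a b sub in auto)
  then have le: "card (cut (A \<union> B)) \<le> card (cut B)" using cut_submodular[of A B] by simp
  have AB: "Q - bd Q \<subseteq> A \<union> B" "A \<union> B \<subseteq> Q" using assms(2) a b by auto
  have "card (cut (A \<union> B)) \<le> card (cut C)" if "Q - bd Q \<subseteq> C" "C \<subseteq> Q" for C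
    using min_cut_le[OF B that] le by simp
  then have "min_cut Q (A \<union> B)" using AB unfolding min_cut_def by simp
  then show ?thesis by blast
qed

section \<open>Prefixes of a path decomposition\<close>

lemma pathwidth_decomposition:
  assumes "pathwidth V E = w" "V \<noteq> {}"
  shows "\<exists>Xs. path_decomposition V E Xs \<and> (\<forall>X\<in>set Xs. card X \<le> Suc w)"
proof -
  \<comment> \<open>The one-bag decomposition shows that the \<open>LEAST\<close> in
    \<open>pathwidth\<close> is attained.\<close>
  have "path_decomposition V E [V]"
    unfolding path_decomposition_def using edge_sub by auto
  then have "\<exists>w Xs. path_decomposition V E Xs \<and> pd_width Xs = w" by blast
  then have "\<exists>Xs. path_decomposition V E Xs \<and> pd_width Xs = pathwidth V E"
    unfolding pathwidth_def by (rule LeastI_ex)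
  then obtain Xs where Xs: "path_decomposition V E Xs" "pd_width Xs = w" using assms(1) by blast
  have "card X \<le> Suc w" if "X \<in> set Xs" for X
  proof -
    have "card X \<le> Max (card ` set Xs)" using that by (intro Max_ge) auto
    then show ?thesis using Xs(2) unfolding pd_width_def by simp
  qed
  then show ?thesis using Xs by blast
qed

lemma path_decompositionD:
  assumes "path_decomposition V E Xs"
  shows "V = \<Union>(set Xs)" "e \<in> E \<Longrightarrow> \<exists>X\<in>set Xs. e \<subseteq> X"
    "i \<le> j \<Longrightarrow> j \<le> k \<Longrightarrow> k < length Xs \<Longrightarrow> Xs ! i \<inter> Xs ! k \<subseteq> Xs ! j"
  using assms unfolding path_decomposition_def by simp_all

text \<open>The edge from \<open>v\<close> to a neighbour outside the prefix lies in some bag from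
  index \<open>i\<close> on, while \<open>v\<close> is also in an earlier bag; interpolation puts
  \<open>v\<close> into bag \<open>i\<close>.\<close>

lemma bd_bag:
  assumes pd: "path_decomposition V E Xs" and i: "i < length Xs"
  shows "bd (\<Union>(set (take i Xs))) \<subseteq> Xs ! i"
proof
  fix v assume "v \<in> bd (\<Union>(set (take i Xs)))"
  then obtain w where v: "v \<in> \<Union>(set (take i Xs))" and w: "w \<in> nb v" "w \<notin> \<Union>(set (take i Xs))"
    unfolding bd_def by blast
  obtain j where j: "j < i" "v \<in> Xs ! j" using v by (auto simp: in_set_conv_nth)
  have "{v, w} \<in> E" using w(1) unfolding nb_def by simp
  from path_decompositionD(2)[OF pd this]
  obtain k where k: "k < length Xs" "{v, w} \<subseteq> Xs ! k" by (auto simp: in_set_conv_nth)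
  have "i \<le> k"
  proof (rule ccontr)
    assume "\<not> i \<le> k"
    then have "Xs ! k \<in> set (take i Xs)" using k(1) by (auto simp: in_set_conv_nth)
    then show False using w(2) k(2) by blast
  qed
  then have "Xs ! j \<inter> Xs ! k \<subseteq> Xs ! i"
    using path_decompositionD(3)[OF pd] j(1) k(1) by simp
  then show "v \<in> Xs ! i" using j k by blast
qed

text \<open>Bag \<open>i\<close> may lie inside the prefix, and then \<open>bd_bag\<close> yields
  only \<open>Suc w\<close>. So take the first bag \<open>j\<close> not contained in the prefix: the
  bags in between add nothing, the prefix up to \<open>j\<close> is the same set, and bag
  \<open>j\<close> has a vertex outside it, which saves one.\<close>

lemma card_bd_prefix:
  assumes pd: "path_decomposition V E Xs" and w: "\<forall>X\<in>set Xs. card X \<le> Suc w"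
  shows "card (bd (\<Union>(set (take i Xs)))) \<le> w"
proof (cases "\<Union>(set (take i Xs)) = V")
  case True
  then have "bd (\<Union>(set (take i Xs))) = {}" unfolding bd_def using nb_V by auto
  then show ?thesis by simp
next
  case False
  let ?P = "\<Union>(set (take i Xs))"
  define J where "J j \<longleftrightarrow> j < length Xs \<and> \<not> Xs ! j \<subseteq> ?P" for j
  note V = path_decompositionD(1)[OF pd]
  have "?P \<subseteq> V" unfolding V using set_take_subset by fastforce
  then obtain X where "X \<in> set Xs" "\<not> X \<subseteq> ?P" using False V by blast
  then have "\<exists>j. J j" unfolding J_def by (auto simp: in_set_conv_nth)
  then obtain j where j: "J j" "\<And>k. k < j \<Longrightarrow> \<not> J k" using exists_least_iff[of J] by blast
  have "i \<le> j"
  proof (rule ccontr)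
    assume "\<not> i \<le> j"
    then have "Xs ! j \<in> set (take i Xs)" using j(1) unfolding J_def by (auto simp: in_set_conv_nth)
    then show False using j(1) unfolding J_def by blast
  qed
  have "\<Union>(set (take j Xs)) = ?P"
  proof (rule subset_antisym)
    show "?P \<subseteq> \<Union>(set (take j Xs))"
      by (rule Union_mono[OF set_take_subset_set_take[OF \<open>i \<le> j\<close>]])
    show "\<Union>(set (take j Xs)) \<subseteq> ?P"
    proof (rule Union_least)
      fix X assume "X \<in> set (take j Xs)"
      then obtain k where "k < j" "k < length Xs" "X = Xs ! k" by (auto simp: in_set_conv_nth)
      then show "X \<subseteq> ?P" using j(2) unfolding J_def by blast
    qed
  qed
  then have "bd ?P \<subseteq> Xs ! j" using bd_bag[OF pd, of j] j(1) unfolding J_def by simp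
  moreover have "bd ?P \<subseteq> ?P" unfolding bd_def by blast
  ultimately have "bd ?P \<subset> Xs ! j" using j(1) unfolding J_def by blast
  moreover have "Xs ! j \<in> set Xs" using j(1) unfolding J_def by simp
  moreover from this have "finite (Xs ! j)" using V finite_sub by blast
  ultimately have "card (bd ?P) < card (Xs ! j)" "card (Xs ! j) \<le> Suc w" using w by (auto intro: psubset_card_mono)
  then show ?thesis by simp
qed

lemma pathwidth_cut_induct:
  assumes pw: "pathwidth V E = w" and ne: "V \<noteq> {}" and base: "Q {}"
    and step: "\<And>A B. A \<subseteq> B \<Longrightarrow> B \<subseteq> V \<Longrightarrow> card (cut A) \<le> w \<Longrightarrow> card (cut B) \<le> w \<Longrightarrow>
      card (B - A) \<le> Suc w \<Longrightarrow> Q A \<Longrightarrow> Q B"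
  shows "Q V"
proof -
  obtain Xs where Xs: "path_decomposition V E Xs" "\<forall>X\<in>set Xs. card X \<le> Suc w"
    using pathwidth_decomposition[OF pw ne] by blast
  let ?P = "\<lambda>i. \<Union>(set (take i Xs))"
  note V = path_decompositionD(1)[OF Xs(1)]
  have PV: "?P i \<subseteq> V" for i unfolding V using set_take_subset by fastforce
  have "\<exists>A. min_cut (?P i) A \<and> Q A" if "i \<le> length Xs" for i
    using that
  proof (induction i)
    case 0
    have "min_cut {} {}" unfolding min_cut_def by simp
    then show ?case using base by auto
  next
    case (Suc i)
    then obtain A where A: "min_cut (?P i) A" "Q A" by auto
    have i: "i < length Xs" using Suc by simp
    have P: "?P (Suc i) = ?P i \<union> Xs ! i" using i by (auto simp: take_Suc_conv_app_nth)
    obtain B where B: "min_cut (?P (Suc i)) B" "A \<subseteq> B"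
      using min_cut_extend[OF A(1), of "?P (Suc i)"] unfolding P by blast
    have sub: "B \<subseteq> ?P (Suc i)" "?P i - bd (?P i) \<subseteq> A" using min_cut_sub A(1) B(1) by auto
    \<comment> \<open>The prefix outside its boundary is already in \<open>A\<close> and the
      boundary lies in bag \<open>i\<close>, so all new vertices come from this bag. This is the
      origin of the bound \<open>Suc w\<close>.\<close>
    have "B - A \<subseteq> Xs ! i" using sub bd_bag[OF Xs(1) i] unfolding P by blast
    moreover have "Xs ! i \<in> set Xs" using i by simp
    then have "finite (Xs ! i)" "card (Xs ! i) \<le> Suc w"
      using Xs(2) V finite_sub[of "Xs ! i"] by blast+
    ultimately have "card (B - A) \<le> Suc w" using card_mono le_trans by blast
    moreover have "card (cut A) \<le> w" "card (cut B) \<le> w"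
      using min_cut_card[OF PV A(1)] min_cut_card[OF PV B(1)] card_bd_prefix[OF Xs] le_trans by blast+
    moreover have "B \<subseteq> V" using sub(1) PV by blast
    ultimately have "Q B" using step B(2) A(2) by blast
    then show ?case using B by blast
  qed
  then obtain A where A: "min_cut V A" "Q A" using V by (metis order_refl take_all)
  have "bd V = {}" unfolding bd_def using nb_V by auto
  then have "A = V" using min_cut_sub[OF A(1)] by auto
  then show ?thesis using A(2) by simp
qed

end

subsection \<open>A closed family of sets of types\<close>

text \<open>\<open>ps\<close> lists the ways to bring the cut edges used by a configuration to the
  front, and \<open>ms\<close> builds the configuration. The reordering \<open>q\<close> is there
  because the target family holds its members only up to the order of the cut edges.\<close>

definition closes :: "lab list list list \<Rightarrow> lab list list list \<Rightarrow> nat \<Rightarrow> move list \<Rightarrow> nat list list \<Rightarrow> bool" where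
  "closes Fam Fam' n ms ps \<longleftrightarrow> (\<forall>X\<in>set Fam. \<forall>p\<in>set ps. \<exists>Y\<in>set Fam'. \<exists>q.
     distinct q \<and> set q = {..<n} \<and> covers (plays (Perm p # ms @ [Perm q]) X) Y)"

text \<open>For each p, the certificate c names the index i of a member of the target family and the reordering q
  that embeds it.\<close>

definition certified :: "lab list list list \<Rightarrow> nat \<Rightarrow> move list \<Rightarrow> nat list list \<Rightarrow>
    lab list list \<Rightarrow> (nat \<times> nat list) list \<Rightarrow> bool" where
  "certified Fam' n ms ps X c \<longleftrightarrow> list_all2 (\<lambda>p (i, q).
     i < length Fam' \<and> length q = n \<and> distinct q \<and> list_all (\<lambda>j. j < n) q \<and>
     covers (plays (Perm p # ms @ [Perm q]) X) (Fam' ! i)) ps c"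

lemma closesI:
  assumes "list_all2 (certified Fam' n ms ps) Fam cs"
  shows "closes Fam Fam' n ms ps"
  unfolding closes_def
proof (intro ballI)
  fix X p assume "X \<in> set Fam" "p \<in> set ps"
  then obtain c where "certified Fam' n ms ps X c"
    using assms by (auto simp: list_all2_conv_all_nth in_set_conv_nth)
  then obtain i q where iq: "i < length Fam'" "length q = n" "distinct q" "list_all (\<lambda>j. j < n) q"
      "covers (plays (Perm p # ms @ [Perm q]) X) (Fam' ! i)"
    using \<open>p \<in> set ps\<close> unfolding certified_def
    by (fastforce simp: list_all2_conv_all_nth in_set_conv_nth)
  have "set q \<subseteq> {..<n}" using iq(4) by (auto simp: list_all_iff)
  moreover have "card (set q) = card {..<n}" using iq(2,3) by (simp add: distinct_card)
  ultimately have "set q = {..<n}" by (intro card_subset_eq) auto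
  then show "\<exists>Y\<in>set Fam'. \<exists>q. distinct q \<and> set q = {..<n} \<and> covers (plays (Perm p # ms @ [Perm q]) X) Y"
    using iq nth_mem by blast
qed

text \<open>The two families were found by computer search: start from the types of a single vertex, apply all moves,
  keep only the sets of types that are minimal up to reordering, and finally thin these out.\<close>

definition fam3 :: "lab list list list" where
  "fam3 = [
    [[Tr 0, Tr 0, Tr 0], [Tr 0, Tr 0, Ma], [Tr 0, Cy, Cy], [Tr 0, Ma, Tr 0], [Cy, Tr 0, Cy],
     [Cy, Cy, Tr 0], [Ma, Tr 0, Tr 0]],
    [[Tr 0, Tr 0, Tr 0], [Tr 0, Tr 0, Tr 1], [Tr 0, Ma, Tr 0], [Tr 0, Ma, Tr 1], [Cy, Cy, Tr 0],
     [Ma, Tr 0, Tr 0], [Ma, Tr 0, Tr 1]],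
    [[Tr 0, Tr 0, Tr 0], [Tr 0, Tr 0, Tr 1], [Tr 0, Tr 1, Tr 0], [Tr 0, Tr 1, Tr 2],
     [Ma, Tr 0, Tr 0], [Ma, Tr 0, Tr 1]],
    [[Tr 0, Tr 0, Tr 0], [Tr 0, Tr 0, Tr 1], [Tr 0, Tr 1, Tr 0], [Tr 0, Tr 1, Tr 1],
     [Tr 0, Tr 1, Tr 2]],
    [[Tr 0, Tr 0, Tr 0], [Tr 0, Tr 0, Tr 1], [Tr 0, Tr 1, Tr 1], [Tr 0, Tr 1, Ma],
     [Tr 0, Cy, Cy], [Tr 0, Ma, Tr 0], [Cy, Cy, Tr 0], [Ma, Tr 0, Tr 1]]]"

definition fam4 :: "lab list list list" where
  "fam4 = [
    [[Tr 0, Tr 0, Tr 0, Tr 0], [Tr 0, Tr 0, Tr 0, Ma], [Tr 0, Tr 0, Tr 1, Tr 1],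
     [Tr 0, Tr 0, Cy, Cy], [Tr 0, Tr 0, Ma, Tr 0], [Tr 0, Cy, Tr 1, Cy], [Tr 0, Cy, Cy, Tr 1],
     [Tr 0, Ma, Tr 0, Tr 0], [Tr 0, Ma, Tr 0, Ma], [Tr 0, Ma, Cy, Cy], [Tr 0, Ma, Ma, Tr 0],
     [Cy, Tr 0, Tr 1, Cy], [Cy, Tr 0, Cy, Tr 1], [Cy, Cy, Tr 0, Tr 0], [Cy, Cy, Tr 0, Ma],
     [Cy, Cy, Ma, Tr 0], [Ma, Tr 0, Tr 0, Tr 0], [Ma, Tr 0, Tr 0, Ma], [Ma, Tr 0, Cy, Cy],
     [Ma, Tr 0, Ma, Tr 0]],
    [[Tr 0, Tr 0, Tr 1, Tr 1], [Tr 0, Tr 0, Cy, Cy], [Tr 0, Tr 0, Ma, Ma],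
     [Tr 0, Tr 1, Tr 0, Tr 1], [Tr 0, Tr 1, Cy, Cy], [Tr 0, Cy, Tr 0, Cy], [Tr 0, Cy, Tr 1, Cy],
     [Tr 0, Cy, Cy, Tr 1], [Tr 0, Cy, Ma, Cy], [Tr 0, Ma, Tr 0, Ma], [Tr 0, Ma, Cy, Cy],
     [Cy, Tr 0, Tr 1, Cy], [Cy, Tr 0, Cy, Tr 0], [Cy, Tr 0, Cy, Tr 1], [Cy, Tr 0, Cy, Ma],
     [Cy, Cy, Tr 0, Tr 0], [Cy, Cy, Tr 0, Tr 1], [Cy, Cy, Tr 0, Ma], [Cy, Cy, Ma, Tr 0],
     [Cy, Ma, Cy, Tr 0], [Ma, Tr 0, Cy, Cy], [Ma, Tr 0, Ma, Tr 0], [Ma, Cy, Tr 0, Cy],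
     [Ma, Ma, Tr 0, Tr 0]],
    [[Tr 0, Tr 0, Tr 0, Tr 0], [Tr 0, Tr 0, Tr 0, Ma], [Tr 0, Tr 0, Tr 1, Tr 1],
     [Tr 0, Tr 0, Tr 1, Ma], [Tr 0, Tr 0, Cy, Cy], [Tr 0, Tr 0, Ma, Tr 0],
     [Tr 0, Tr 0, Ma, Tr 1], [Tr 0, Ma, Tr 0, Tr 0], [Tr 0, Ma, Tr 1, Tr 1],
     [Tr 0, Ma, Tr 1, Ma], [Tr 0, Ma, Cy, Cy], [Tr 0, Ma, Ma, Tr 0], [Tr 0, Ma, Ma, Tr 1],
     [Cy, Cy, Tr 0, Tr 0], [Cy, Cy, Tr 0, Ma], [Cy, Cy, Ma, Tr 0], [Ma, Tr 0, Tr 0, Tr 0],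
     [Ma, Tr 0, Tr 0, Ma], [Ma, Tr 0, Tr 1, Tr 1], [Ma, Tr 0, Tr 1, Ma], [Ma, Tr 0, Cy, Cy],
     [Ma, Tr 0, Ma, Tr 1]],
    [[Tr 0, Tr 0, Tr 0, Tr 0], [Tr 0, Tr 0, Cy, Cy], [Tr 0, Tr 0, Ma, Tr 0],
     [Tr 0, Tr 1, Tr 0, Tr 0], [Tr 0, Tr 1, Tr 0, Ma], [Tr 0, Tr 1, Tr 1, Tr 1],
     [Tr 0, Tr 1, Tr 1, Ma], [Tr 0, Tr 1, Tr 2, Tr 2], [Tr 0, Tr 1, Tr 2, Ma],
     [Tr 0, Tr 1, Cy, Cy], [Tr 0, Tr 1, Ma, Tr 0], [Tr 0, Tr 1, Ma, Tr 1],
     [Tr 0, Tr 1, Ma, Tr 2]],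
    [[Tr 0, Tr 0, Tr 1, Tr 1], [Tr 0, Tr 0, Cy, Cy], [Tr 0, Tr 0, Ma, Ma],
     [Tr 0, Tr 1, Tr 0, Tr 1], [Tr 0, Tr 1, Tr 2, Tr 1], [Tr 0, Tr 1, Tr 2, Tr 2],
     [Tr 0, Tr 1, Cy, Cy], [Tr 0, Tr 1, Ma, Ma], [Tr 0, Cy, Tr 0, Cy], [Tr 0, Cy, Tr 1, Cy],
     [Tr 0, Ma, Tr 0, Ma], [Tr 0, Ma, Tr 1, Ma]],
    [[Tr 0, Tr 0, Tr 0, Tr 0], [Tr 0, Tr 0, Tr 0, Ma], [Tr 0, Tr 0, Tr 1, Tr 1],
     [Tr 0, Tr 0, Cy, Cy], [Tr 0, Tr 0, Ma, Tr 0], [Tr 0, Tr 1, Tr 0, Tr 0],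
     [Tr 0, Tr 1, Tr 0, Ma], [Tr 0, Tr 1, Tr 1, Ma], [Tr 0, Tr 1, Cy, Cy],
     [Tr 0, Tr 1, Ma, Tr 0], [Tr 0, Tr 1, Ma, Tr 1], [Tr 0, Cy, Tr 1, Cy], [Tr 0, Cy, Cy, Tr 1],
     [Tr 0, Ma, Tr 1, Tr 1], [Tr 0, Ma, Tr 1, Ma], [Tr 0, Ma, Ma, Tr 1], [Cy, Tr 0, Tr 1, Cy],
     [Cy, Tr 0, Cy, Tr 1], [Ma, Tr 0, Tr 1, Tr 1], [Ma, Tr 0, Tr 1, Ma], [Ma, Tr 0, Ma, Tr 1]],
    [[Tr 0, Tr 0, Tr 0, Tr 0], [Tr 0, Tr 0, Tr 1, Tr 2], [Tr 0, Tr 1, Tr 0, Tr 1],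
     [Tr 0, Tr 1, Tr 1, Tr 1], [Tr 0, Tr 1, Tr 1, Ma], [Tr 0, Tr 1, Tr 2, Tr 3],
     [Tr 0, Tr 1, Ma, Tr 1], [Tr 0, Ma, Tr 0, Tr 0], [Tr 0, Ma, Tr 0, Tr 1],
     [Tr 0, Ma, Tr 1, Tr 0], [Tr 0, Ma, Tr 1, Tr 1], [Tr 0, Ma, Tr 1, Tr 2],
     [Ma, Tr 0, Tr 0, Tr 1], [Ma, Tr 0, Tr 1, Tr 0]],
    [[Tr 0, Tr 0, Tr 0, Tr 0], [Tr 0, Tr 0, Tr 0, Ma], [Tr 0, Tr 0, Tr 1, Tr 1],
     [Tr 0, Tr 0, Cy, Cy], [Tr 0, Tr 1, Tr 0, Tr 0], [Tr 0, Tr 1, Tr 0, Ma],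
     [Tr 0, Tr 1, Tr 2, Tr 2], [Tr 0, Tr 1, Tr 2, Ma], [Tr 0, Tr 1, Cy, Cy],
     [Tr 0, Tr 1, Ma, Tr 0], [Tr 0, Tr 1, Ma, Tr 2], [Ma, Tr 0, Tr 0, Ma], [Ma, Tr 0, Tr 1, Ma],
     [Ma, Tr 0, Ma, Tr 0]],
    [[Tr 0, Tr 0, Tr 0, Tr 0], [Tr 0, Tr 0, Tr 0, Ma], [Tr 0, Tr 0, Tr 1, Tr 1],
     [Tr 0, Tr 0, Cy, Cy], [Tr 0, Tr 0, Ma, Tr 0], [Tr 0, Tr 1, Tr 0, Tr 0],
     [Tr 0, Tr 1, Tr 0, Ma], [Tr 0, Tr 1, Tr 2, Tr 2], [Tr 0, Tr 1, Cy, Cy],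
     [Tr 0, Tr 1, Ma, Tr 0], [Cy, Tr 0, Tr 1, Cy], [Cy, Tr 0, Cy, Tr 1], [Ma, Tr 0, Tr 0, Tr 0],
     [Ma, Tr 0, Tr 0, Ma], [Ma, Tr 0, Tr 1, Tr 1], [Ma, Tr 0, Tr 1, Ma], [Ma, Tr 0, Ma, Tr 0],
     [Ma, Tr 0, Ma, Tr 1]],
    [[Tr 0, Tr 0, Tr 0, Tr 0], [Tr 0, Tr 0, Tr 1, Tr 0], [Tr 0, Tr 0, Tr 1, Tr 1],
     [Tr 0, Tr 0, Cy, Cy], [Tr 0, Tr 0, Ma, Tr 0], [Tr 0, Tr 0, Ma, Tr 1], [Tr 0, Tr 0, Ma, Ma],
     [Tr 0, Tr 1, Tr 1, Tr 1], [Tr 0, Tr 1, Tr 1, Ma], [Tr 0, Tr 1, Tr 2, Tr 1],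
     [Tr 0, Tr 1, Cy, Cy], [Tr 0, Tr 1, Ma, Tr 1], [Tr 0, Tr 1, Ma, Ma], [Tr 0, Cy, Tr 1, Cy],
     [Tr 0, Cy, Cy, Tr 1], [Tr 0, Ma, Tr 0, Tr 0], [Tr 0, Ma, Tr 0, Ma], [Tr 0, Ma, Tr 1, Tr 0],
     [Tr 0, Ma, Cy, Cy], [Cy, Tr 0, Tr 1, Cy], [Cy, Cy, Tr 0, Tr 0], [Cy, Cy, Tr 0, Tr 1],
     [Cy, Cy, Tr 0, Ma], [Cy, Cy, Ma, Tr 0], [Ma, Tr 0, Tr 0, Tr 0], [Ma, Tr 0, Tr 1, Tr 0],
     [Ma, Tr 0, Tr 1, Tr 1], [Ma, Tr 0, Cy, Cy], [Ma, Tr 0, Ma, Tr 1], [Ma, Cy, Tr 0, Cy],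
     [Ma, Ma, Tr 0, Tr 0], [Ma, Ma, Tr 0, Ma]],
    [[Tr 0, Tr 0, Tr 0, Tr 0], [Tr 0, Tr 0, Tr 0, Ma], [Tr 0, Tr 0, Ma, Tr 0],
     [Tr 0, Tr 0, Ma, Ma], [Tr 0, Tr 1, Tr 0, Tr 0], [Tr 0, Tr 1, Tr 0, Tr 1],
     [Tr 0, Tr 1, Tr 0, Ma], [Tr 0, Tr 1, Tr 1, Tr 1], [Tr 0, Tr 1, Tr 2, Tr 2],
     [Tr 0, Tr 1, Tr 2, Tr 3], [Tr 0, Tr 1, Ma, Tr 1], [Tr 0, Cy, Tr 0, Cy],
     [Tr 0, Cy, Cy, Tr 1], [Tr 0, Cy, Ma, Cy], [Tr 0, Ma, Tr 0, Tr 0], [Tr 0, Ma, Tr 0, Tr 1],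
     [Tr 0, Ma, Cy, Cy], [Tr 0, Ma, Ma, Tr 0], [Tr 0, Ma, Ma, Tr 1], [Cy, Tr 0, Tr 1, Cy],
     [Cy, Tr 0, Cy, Tr 0], [Cy, Tr 0, Cy, Ma], [Cy, Ma, Cy, Tr 0], [Ma, Tr 0, Tr 0, Ma],
     [Ma, Tr 0, Tr 1, Tr 0], [Ma, Tr 0, Tr 1, Tr 2], [Ma, Tr 0, Cy, Cy], [Ma, Cy, Tr 0, Cy],
     [Ma, Ma, Tr 0, Tr 1]],
    [[Tr 0, Tr 0, Tr 0, Tr 0], [Tr 0, Tr 0, Tr 0, Tr 1], [Tr 0, Tr 0, Tr 1, Tr 1],
     [Tr 0, Tr 0, Tr 1, Tr 2], [Tr 0, Tr 0, Tr 1, Ma], [Tr 0, Tr 0, Cy, Cy],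
     [Tr 0, Tr 0, Ma, Tr 0], [Tr 0, Cy, Cy, Tr 1], [Tr 0, Ma, Tr 0, Tr 0],
     [Tr 0, Ma, Tr 0, Tr 1], [Tr 0, Ma, Tr 1, Tr 1], [Tr 0, Ma, Tr 1, Ma], [Tr 0, Ma, Ma, Tr 0],
     [Cy, Tr 0, Cy, Tr 1], [Cy, Cy, Tr 0, Tr 0], [Cy, Cy, Tr 0, Tr 1], [Cy, Cy, Ma, Tr 0],
     [Ma, Tr 0, Tr 0, Tr 0], [Ma, Tr 0, Tr 0, Tr 1], [Ma, Tr 0, Tr 1, Tr 1],
     [Ma, Tr 0, Tr 1, Ma], [Ma, Tr 0, Ma, Tr 0]],
    [[Tr 0, Tr 0, Tr 0, Tr 0], [Tr 0, Tr 0, Tr 1, Tr 1], [Tr 0, Tr 0, Ma, Ma],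
     [Tr 0, Tr 1, Tr 0, Tr 1], [Tr 0, Tr 1, Tr 0, Tr 2], [Tr 0, Tr 1, Tr 1, Ma],
     [Tr 0, Tr 1, Tr 2, Tr 3], [Tr 0, Tr 1, Cy, Cy], [Tr 0, Tr 1, Ma, Tr 0],
     [Tr 0, Tr 1, Ma, Ma], [Tr 0, Cy, Tr 0, Cy], [Tr 0, Cy, Ma, Cy], [Tr 0, Ma, Tr 1, Tr 1],
     [Cy, Tr 0, Cy, Tr 0], [Cy, Tr 0, Cy, Ma], [Ma, Tr 0, Tr 1, Tr 0], [Ma, Tr 0, Tr 1, Tr 1],
     [Ma, Tr 0, Cy, Cy], [Ma, Ma, Tr 0, Tr 1]]]"

text \<open>The first two positions are the cut edges that a configuration uses. Unordered pairs
  suffice when a symmetry exchanges the two; the order of the other edges is absorbed by the final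
  reordering in \<open>closes\<close>.\<close>

definition pairs4 :: "nat list list" where
  "pairs4 = [[0,1,2,3], [0,2,1,3], [0,3,1,2], [1,2,0,3], [1,3,0,2], [2,3,0,1]]"

text \<open>For the triangle both orders count: one attached vertex lies on the triangle, the other
  hangs from it.\<close>

definition ordered_pairs4 :: "nat list list" where
  "ordered_pairs4 = [[0,1,2,3], [0,2,1,3], [0,3,1,2], [1,0,2,3], [1,2,0,3], [1,3,0,2],
    [2,0,1,3], [2,1,0,3], [2,3,0,1], [3,0,1,2], [3,1,0,2], [3,2,0,1]]"

text \<open>The leaves of a claw are interchangeable, so only the position left out matters.\<close>

definition triples4 :: "nat list list" where
  "triples4 = [[1,2,3,0], [0,2,3,1], [0,1,3,2], [0,1,2,3]]"

definition singles3 :: "nat list list" where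
  "singles3 = [[0,1,2], [1,0,2], [2,0,1]]"

text \<open>This and the next five lemmas are finite checks, evaluated by rewriting. A row of
  \<open>cs\<close> belongs to a member of the source family, an entry of the row to an element of
  the position list.\<close>

lemma closes_split: "closes fam3 fam4 4
    [Split] singles3"
  by (rule closesI[where cs = "[
      [(0,[0,1,2,3]), (0,[0,1,2,3]), (0,[0,1,2,3])],
      [(8,[2,3,0,1]), (8,[2,3,0,1]), (2,[0,1,2,3])],
      [(3,[2,3,0,1]), (7,[2,3,0,1]), (7,[2,3,0,1])],
      [(3,[2,3,0,1]), (3,[2,3,0,1]), (3,[2,3,0,1])],
      [(11,[0,1,2,3]), (5,[2,3,0,1]), (11,[0,1,3,2])]]"]) code_simp

lemma closes_join: "closes fam4 fam3 3
    [Join] pairs4"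
  by (rule closesI[where cs = "[
      [(1,[1,2,0]), (0,[0,1,2]), (0,[0,1,2]), (0,[0,1,2]), (0,[0,1,2]), (1,[1,2,0])],
      [(0,[0,1,2]), (0,[0,1,2]), (0,[0,1,2]), (0,[0,1,2]), (0,[0,1,2]), (0,[0,1,2])],
      [(1,[1,2,0]), (4,[1,0,2]), (4,[1,0,2]), (4,[1,0,2]), (4,[1,0,2]), (1,[1,2,0])],
      [(1,[1,2,0]), (1,[0,2,1]), (1,[0,2,1]), (1,[0,2,1]), (1,[0,2,1]), (3,[0,1,2])],
      [(1,[0,2,1]), (1,[0,2,1]), (1,[0,1,2]), (1,[0,2,1]), (1,[0,2,1]), (1,[0,2,1])],
      [(1,[1,2,0]), (1,[1,2,0]), (1,[1,2,0]), (1,[1,2,0]), (1,[1,2,0]), (3,[0,1,2])],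
      [(3,[0,1,2]), (2,[1,0,2]), (2,[1,0,2]), (2,[0,1,2]), (3,[0,1,2]), (2,[2,0,1])],
      [(1,[1,2,0]), (1,[0,2,1]), (1,[0,2,1]), (1,[0,2,1]), (1,[0,2,1]), (2,[1,0,2])],
      [(1,[1,2,0]), (1,[0,2,1]), (1,[0,2,1]), (4,[0,2,1]), (4,[0,2,1]), (2,[1,0,2])],
      [(1,[1,2,0]), (0,[0,1,2]), (0,[0,1,2]), (0,[0,1,2]), (4,[1,0,2]), (1,[1,2,0])],
      [(0,[0,1,2]), (1,[1,2,0]), (0,[0,1,2]), (0,[0,1,2]), (1,[1,2,0]), (4,[1,0,2])],
      [(2,[1,0,2]), (1,[0,2,1]), (0,[0,1,2]), (1,[0,2,1]), (0,[0,1,2]), (1,[1,2,0])],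
      [(0,[0,1,2]), (1,[1,2,0]), (1,[0,1,2]), (1,[0,1,2]), (1,[1,2,0]), (1,[0,1,2])]]"]) code_simp

text \<open>Cut sizes 4, 5, 4: after one end of the rung is added, the permutation puts the rung
  edge beside the cut edge at the other end.\<close>

lemma closes_rung: "closes fam4 fam4 4
    [Split, Perm [1,2,0,3,4], Join] pairs4"
  by (rule closesI[where cs = "[
      [(0,[0,1,2,3]), (1,[0,1,3,2]), (1,[0,1,3,2]), (1,[0,1,3,2]), (1,[0,1,3,2]), (0,[0,1,2,3])],
      [(0,[0,3,1,2]), (0,[0,3,1,2]), (1,[0,2,3,1]), (1,[0,2,3,1]), (0,[0,3,1,2]), (0,[0,3,1,2])],
      [(2,[0,1,2,3]), (9,[2,1,3,0]), (9,[2,1,3,0]), (9,[2,1,3,0]), (9,[2,1,3,0]), (2,[0,1,2,3])],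
      [(3,[0,1,2,3]), (8,[3,2,0,1]), (8,[3,2,0,1]), (8,[3,2,0,1]), (8,[3,2,0,1]), (3,[2,3,0,1])],
      [(8,[1,2,0,3]), (8,[1,2,0,3]), (8,[1,2,0,3]), (4,[2,0,1,3]), (8,[1,2,0,3]), (8,[1,2,0,3])],
      [(0,[0,1,2,3]), (12,[1,2,0,3]), (12,[1,2,0,3]), (12,[1,2,0,3]), (12,[1,2,0,3]),
       (5,[2,3,0,1])],
      [(3,[2,3,0,1]), (6,[1,2,0,3]), (6,[1,2,0,3]), (3,[2,3,0,1]), (3,[2,3,0,1]), (6,[2,3,1,0])],
      [(7,[1,0,2,3]), (4,[2,1,3,0]), (4,[2,1,3,0]), (4,[2,1,3,0]), (4,[2,1,3,0]), (7,[2,3,0,1])],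
      [(11,[2,3,1,0]), (4,[2,1,3,0]), (4,[2,1,3,0]), (9,[1,0,2,3]), (9,[1,0,2,3]), (8,[2,3,0,1])],
      [(7,[0,1,3,2]), (0,[0,3,1,2]), (0,[0,1,2,3]), (0,[0,3,1,2]), (10,[2,3,1,0]), (7,[0,1,3,2])],
      [(0,[0,1,2,3]), (11,[0,1,3,2]), (0,[0,1,2,3]), (0,[0,2,1,3]), (7,[3,2,1,0]), (9,[3,0,2,1])],
      [(11,[0,1,2,3]), (12,[2,3,1,0]), (4,[3,0,2,1]), (12,[2,3,1,0]), (4,[3,0,2,1]),
       (8,[1,0,2,3])],
      [(0,[0,3,1,2]), (7,[3,2,0,1]), (4,[2,0,3,1]), (7,[2,3,1,0]), (7,[3,2,0,1]), (7,[0,3,2,1])]]"]) code_simp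

text \<open>Cut sizes 4, 5, 6, 5, 4. The two attached vertices are opposite on the square and come
  before the others, each of which joins one edge from both.\<close>

lemma closes_square: "closes fam4 fam4 4
    [Split, Perm [2,0,1,3,4], Split, Perm [0,2,1,3,4,5], Join, Perm [1,2,0,3,4], Join] pairs4"
  by (rule closesI[where cs = "[
      [(0,[0,1,2,3]), (1,[0,2,3,1]), (1,[0,2,3,1]), (1,[0,2,3,1]), (1,[0,2,3,1]), (0,[0,1,2,3])],
      [(1,[0,2,3,1]), (1,[0,2,3,1]), (1,[0,2,3,1]), (1,[0,2,3,1]), (1,[0,2,3,1]), (1,[0,2,3,1])],
      [(2,[0,1,2,3]), (6,[2,3,0,1]), (6,[2,3,0,1]), (6,[2,3,0,1]), (6,[2,3,0,1]), (2,[0,1,2,3])],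
      [(3,[0,1,2,3]), (3,[0,2,1,3]), (3,[0,2,1,3]), (3,[0,2,1,3]), (3,[0,2,1,3]), (3,[2,3,0,1])],
      [(4,[0,1,2,3]), (4,[0,1,2,3]), (4,[0,2,3,1]), (4,[2,0,1,3]), (4,[2,0,1,3]), (4,[2,0,1,3])],
      [(0,[0,1,2,3]), (6,[2,3,0,1]), (6,[2,3,0,1]), (5,[0,1,2,3]), (5,[0,1,2,3]), (5,[2,3,0,1])],
      [(3,[2,3,0,1]), (6,[0,2,1,3]), (6,[0,2,1,3]), (3,[2,3,0,1]), (3,[2,3,0,1]), (6,[2,3,0,1])],
      [(3,[0,1,2,3]), (4,[2,0,1,3]), (4,[2,0,1,3]), (3,[0,2,1,3]), (3,[0,2,1,3]), (7,[2,3,0,1])],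
      [(0,[0,1,2,3]), (4,[2,0,1,3]), (4,[2,0,1,3]), (0,[0,1,2,3]), (0,[0,1,2,3]), (8,[2,3,0,1])],
      [(3,[0,1,2,3]), (1,[0,2,3,1]), (0,[0,1,2,3]), (1,[0,2,3,1]), (6,[2,3,0,1]), (0,[0,1,2,3])],
      [(0,[0,1,2,3]), (0,[0,1,2,3]), (1,[0,2,3,1]), (1,[0,2,3,1]), (7,[3,2,0,1]), (3,[2,3,0,1])],
      [(11,[0,1,2,3]), (6,[3,2,0,1]), (0,[0,1,2,3]), (6,[3,2,0,1]), (0,[0,1,2,3]), (0,[0,1,2,3])],
      [(1,[0,2,3,1]), (6,[2,3,0,1]), (3,[2,3,0,1]), (3,[2,3,0,1]), (6,[2,3,0,1]), (3,[2,3,0,1])]]"]) code_simp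

text \<open>The configuration is a triangle with a pendant vertex. The two splits add an attached
  triangle vertex and the attached pendant one; the joins add the other two triangle
  vertices.\<close>

lemma closes_triangle: "closes fam4 fam4 4
    [Split, Perm [2,0,1,3,4], Split, Perm [2,0,3,1,4,5], Join, Join] ordered_pairs4"
  by (rule closesI[where cs = "[
      [(0,[0,1,2,3]), (1,[0,1,2,3]), (1,[0,1,2,3]), (0,[0,1,2,3]), (1,[0,1,2,3]), (1,[0,1,2,3]),
       (1,[0,1,3,2]), (1,[0,1,3,2]), (0,[0,1,2,3]), (1,[0,1,3,2]), (1,[0,1,3,2]), (0,[0,1,2,3])],
      [(0,[0,2,1,3]), (0,[0,2,1,3]), (1,[0,2,3,1]), (0,[0,3,1,2]), (1,[0,2,3,1]), (0,[0,2,1,3]),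
       (0,[0,3,1,2]), (1,[0,2,3,1]), (0,[0,2,1,3]), (1,[0,2,3,1]), (0,[0,3,1,2]), (0,[0,3,1,2])],
      [(2,[0,1,3,2]), (3,[0,2,1,3]), (3,[0,2,1,3]), (2,[0,1,2,3]), (3,[0,2,1,3]), (3,[0,2,1,3]),
       (3,[0,3,1,2]), (3,[0,3,1,2]), (2,[0,1,3,2]), (3,[0,3,1,2]), (3,[0,3,1,2]), (2,[0,1,2,3])],
      [(3,[0,1,2,3]), (3,[0,2,1,3]), (3,[0,2,1,3]), (3,[0,1,2,3]), (3,[0,2,1,3]), (3,[0,2,1,3]),
       (8,[3,2,0,1]), (8,[3,2,0,1]), (3,[2,3,1,0]), (8,[3,2,0,1]), (8,[3,2,0,1]), (3,[2,3,0,1])],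
      [(7,[0,2,1,3]), (7,[0,2,1,3]), (7,[0,2,1,3]), (8,[1,2,0,3]), (4,[2,0,1,3]), (7,[0,2,1,3]),
       (8,[1,2,0,3]), (4,[2,0,1,3]), (7,[0,2,1,3]), (8,[1,2,0,3]), (8,[1,2,0,3]), (8,[1,2,0,3])],
      [(0,[0,1,2,3]), (3,[0,2,1,3]), (3,[0,2,1,3]), (0,[0,1,2,3]), (3,[0,2,1,3]), (3,[0,2,1,3]),
       (8,[3,2,0,1]), (7,[0,1,2,3]), (5,[2,3,0,1]), (8,[3,2,0,1]), (7,[0,1,2,3]), (5,[2,3,0,1])],
      [(3,[2,3,0,1]), (6,[0,2,1,3]), (6,[0,2,1,3]), (3,[2,3,0,1]), (3,[2,3,0,1]), (3,[2,3,1,0]),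
       (6,[1,2,0,3]), (3,[2,3,0,1]), (6,[2,3,0,1]), (6,[1,2,0,3]), (3,[2,3,0,1]), (6,[2,3,1,0])],
      [(7,[0,1,2,3]), (3,[0,2,1,3]), (4,[2,0,3,1]), (7,[1,0,2,3]), (3,[0,2,1,3]), (3,[0,2,1,3]),
       (4,[2,1,3,0]), (4,[2,1,3,0]), (7,[2,3,1,0]), (4,[2,1,3,0]), (4,[2,1,3,0]), (7,[2,3,0,1])],
      [(3,[0,1,2,3]), (3,[0,2,1,3]), (3,[0,2,1,3]), (2,[0,1,2,3]), (4,[0,1,2,3]), (4,[0,1,2,3]),
       (4,[2,1,3,0]), (3,[0,1,2,3]), (8,[2,3,0,1]), (4,[2,1,3,0]), (3,[0,1,2,3]), (8,[2,3,0,1])],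
      [(7,[1,0,3,2]), (0,[0,2,1,3]), (0,[0,1,2,3]), (7,[0,1,3,2]), (0,[0,2,1,3]), (7,[2,0,1,3]),
       (0,[0,3,1,2]), (0,[0,3,1,2]), (7,[1,0,2,3]), (0,[0,1,2,3]), (7,[3,0,1,2]), (3,[0,1,2,3])],
      [(0,[0,1,2,3]), (7,[3,2,0,1]), (0,[0,1,2,3]), (0,[0,1,2,3]), (0,[0,3,1,2]), (7,[3,2,0,1]),
       (7,[1,0,2,3]), (0,[0,2,1,3]), (3,[0,2,1,3]), (0,[0,1,2,3]), (7,[3,2,0,1]), (7,[0,3,1,2])],
      [(11,[0,1,2,3]), (8,[1,3,0,2]), (4,[1,0,3,2]), (11,[0,1,2,3]), (8,[1,3,0,2]),
       (4,[1,0,3,2]), (3,[0,3,1,2]), (3,[0,3,1,2]), (2,[0,1,2,3]), (3,[0,3,1,2]), (3,[0,3,1,2]),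
       (7,[1,0,2,3])],
      [(0,[0,2,1,3]), (7,[3,2,1,0]), (4,[2,1,3,0]), (0,[0,3,1,2]), (7,[2,3,0,1]), (7,[1,0,3,2]),
       (7,[3,2,0,1]), (4,[2,0,3,1]), (7,[1,3,2,0]), (4,[2,0,3,1]), (7,[3,2,0,1]), (7,[0,3,2,1])]]"]) code_simp

lemma closes_claw: "closes fam4 fam4 4
    [Split, Perm [2,0,1,3,4], Split, Perm [2,0,3,1,4,5], Join, Perm [0,3,1,2,4], Join] triples4"
  by (rule closesI[where cs = "[
      [(1,[0,1,3,2]), (1,[0,1,3,2]), (1,[0,1,2,3]), (1,[0,1,2,3])],
      [(0,[0,1,2,3]), (0,[0,2,1,3]), (0,[0,2,1,3]), (0,[0,1,2,3])],
      [(0,[0,2,1,3]), (0,[0,2,1,3]), (0,[0,3,1,2]), (0,[0,3,1,2])],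
      [(3,[1,3,0,2]), (3,[1,3,0,2]), (0,[0,3,1,2]), (4,[3,1,2,0])],
      [(4,[3,1,2,0]), (5,[1,2,0,3]), (5,[1,2,0,3]), (5,[0,1,2,3])],
      [(6,[3,1,0,2]), (6,[3,1,0,2]), (0,[0,1,2,3]), (0,[0,1,2,3])],
      [(3,[0,3,1,2]), (3,[1,3,0,2]), (3,[0,3,1,2]), (3,[0,3,1,2])],
      [(3,[1,3,0,2]), (4,[3,0,2,1]), (4,[3,1,2,0]), (0,[0,3,1,2])],
      [(6,[3,1,0,2]), (4,[3,0,2,1]), (0,[0,2,1,3]), (0,[0,2,1,3])],
      [(0,[0,2,1,3]), (0,[0,1,2,3]), (0,[0,1,2,3]), (0,[0,3,1,2])],
      [(0,[0,1,2,3]), (0,[0,1,2,3]), (0,[0,1,2,3]), (0,[0,1,2,3])],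
      [(0,[0,1,2,3]), (0,[0,1,2,3]), (0,[0,3,1,2]), (6,[3,0,1,2])],
      [(3,[0,3,1,2]), (4,[1,2,3,0]), (0,[0,2,1,3]), (0,[0,1,2,3])]]"]) code_simp

subsection \<open>Adding configurations to a fragment\<close>

text \<open>The star patterns of \<open>ok_star\<close>, but with distinct names on the tree edges,
  so that the last vertex closes no cycle.\<close>

fun final :: "lab list \<Rightarrow> bool" where
  "final [Tr a, Tr b, Tr c] = (a \<noteq> b \<and> a \<noteq> c \<and> b \<noteq> c)"
| "final [Tr a, Tr b, Ma] = (a \<noteq> b)"
| "final [Tr a, Ma, Tr b] = (a \<noteq> b)"
| "final [Ma, Tr a, Tr b] = (a \<noteq> b)"
| "final [Tr a, Cy, Cy] = True"
| "final [Cy, Tr a, Cy] = True"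
| "final [Cy, Cy, Tr a] = True"
| "final _ = False"

lemma fam3_final: "\<forall>X\<in>set fam3. \<exists>t\<in>set X. final t"
  by (simp add: fam3_def)

lemma fam3_hd: "t \<in> set (hd fam3) \<Longrightarrow> length t = 3 \<and> ok_star 0 (mset t)"
  by (auto simp: fam3_def ok_star_def)

lemma final_ok_star:
  assumes "final t" "K = {a. Tr a \<in> set t}"
  shows "\<exists>m\<in>K. ok_star m (mset (map (relabel (merge K m)) t))"
    and "length t = 3"
    and "i < length t \<Longrightarrow> j < length t \<Longrightarrow> t ! i = Tr a \<Longrightarrow> t ! j = Tr a \<Longrightarrow> i = j"
  using assms(1) unfolding assms(2)
  by (induction t rule: final.induct; force simp: ok_star_def merge_def less_Suc_eq numeral_3_eq_3)+

lemma plays_append: "plays (ms @ ms') ts = plays ms' (plays ms ts)"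
  by (induction ms arbitrary: ts) auto

lemma reord_distinct:
  assumes "distinct es" "distinct p" "set p = {..<length es}"
  shows "distinct (reord p es)" "set (reord p es) = set es"
proof -
  show "distinct (reord p es)"
    unfolding reord_def using assms by (auto simp: distinct_map inj_on_def nth_eq_iff_index_eq)
  have "set es = (!) es ` {..<length es}" by (auto simp: set_conv_nth)
  then show "set (reord p es) = set es" unfolding reord_def using assms(3) by simp
qed

lemma length_3E: assumes "length es = 3" obtains x y z where "es = [x, y, z]"
  using assms by (auto simp: numeral_3_eq_3 length_Suc_conv)

lemma length_4E: assumes "length es = 4" obtains x y z w where "es = [x, y, z, w]"
  using assms by (auto simp: eval_nat_numeral length_Suc_conv)

lemma singles3_reord:
  assumes "length es = 3" "x \<in> set es"
  shows "\<exists>p\<in>set singles3. \<exists>c d. reord p es = [x, c, d]"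
  using assms(1) by (rule length_3E) (use assms(2) in \<open>auto simp: singles3_def reord_def\<close>)

lemma pairs4_reord:
  assumes "length es = 4" "x \<in> set es" "y \<in> set es" "x \<noteq> y"
  shows "\<exists>p\<in>set pairs4. \<exists>c d. reord p es = [x, y, c, d] \<or> reord p es = [y, x, c, d]"
  using assms(1) by (rule length_4E) (use assms(2-4) in \<open>auto simp: pairs4_def reord_def\<close>)

lemma ordered_pairs4_reord:
  assumes "length es = 4" "x \<in> set es" "y \<in> set es" "x \<noteq> y"
  shows "\<exists>p\<in>set ordered_pairs4. \<exists>c d. reord p es = [x, y, c, d]"
  using assms(1) by (rule length_4E) (use assms(2-4) in \<open>auto simp: ordered_pairs4_def reord_def\<close>)

lemma triples4_reord:
  assumes "length es = 4" "x \<in> set es" "y \<in> set es" "z \<in> set es" "x \<noteq> y" "x \<noteq> z" "y \<noteq> z"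
  shows "\<exists>p\<in>set triples4. \<exists>d. reord p es \<in> {[x, y, z, d], [x, z, y, d], [y, x, z, d], [y, z, x, d], [z, x, y, d], [z, y, x, d]}"
  using assms(1)
proof (rule length_4E)
  fix a b c d assume es: "es = [a, b, c, d]"
  have "x = a \<or> x = b \<or> x = c \<or> x = d" "y = a \<or> y = b \<or> y = c \<or> y = d" "z = a \<or> z = b \<or> z = c \<or> z = d"
    using assms(2-4) es by auto
  then show ?thesis
    unfolding es triples4_def reord_def using assms(5-7) by (elim disjE; simp)
qed

lemma perms_reord:
  "p \<in> set singles3 \<Longrightarrow> distinct p \<and> set p = {..<3}"
  "p \<in> set pairs4 \<Longrightarrow> distinct p \<and> set p = {..<4}"
  "p \<in> set ordered_pairs4 \<Longrightarrow> distinct p \<and> set p = {..<4}"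
  "p \<in> set triples4 \<Longrightarrow> distinct p \<and> set p = {..<4}"
  by (auto simp: singles3_def pairs4_def ordered_pairs4_def triples4_def)

section \<open>The invariant on fragments\<close>

context cubic_graph begin

definition frag :: "'a set \<Rightarrow> 'a set list \<Rightarrow> lab list list \<Rightarrow> bool" where
  "frag A es ts \<longleftrightarrow> A \<subseteq> V \<and> distinct es \<and> set es = cut A \<and> realises_all A es ts"

text \<open>Cuts of 5 or 6 edges inside a configuration appear only as \<open>frag\<close> with the
  type list computed by the moves.\<close>

definition good :: "'a set \<Rightarrow> bool" where
  "good A \<longleftrightarrow> (\<exists>es. (length es = 3 \<and> (\<exists>X\<in>set fam3. frag A es X)) \<or>
     (length es = 4 \<and> (\<exists>X\<in>set fam4. frag A es X)))"

lemma frag_perm: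
  assumes "frag A es ts" "distinct p" "set p = {..<length es}"
  shows "frag A (reord p es) (plays [Perm p] ts)"
proof -
  have "realises_all A (reord p es) (plays [Perm p] ts)"
    using realises_all_perm[of A es ts p] assms(1,3) unfolding frag_def by simp
  then show ?thesis using assms(1) reord_distinct[OF _ assms(2,3)] unfolding frag_def by simp
qed

lemma inc_eq: "nb v = {x, y, z} \<Longrightarrow> inc v = {{v, x}, {v, y}, {v, z}}"
  unfolding inc_nb by auto

lemma star_in_cut: "v \<notin> A \<Longrightarrow> w \<in> nb v \<Longrightarrow> {v, w} \<in> cut A \<longleftrightarrow> w \<in> A"
  unfolding cut_def nb_def by auto

text \<open>Matches the list update of a move with the symmetric difference in
  \<open>cut_insert\<close>.\<close>

lemma sym_diff_swap:
  "C = insert x R \<Longrightarrow> x \<notin> R \<Longrightarrow> y \<notin> C \<Longrightarrow> z \<notin> C \<Longrightarrow> insert y (insert z R) = (C - {x, y, z}) \<union> ({x, y, z} - C)"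
  "C = insert x (insert y R) \<Longrightarrow> x \<notin> R \<Longrightarrow> y \<notin> R \<Longrightarrow> z \<notin> C \<Longrightarrow> insert z R = (C - {x, y, z}) \<union> ({x, y, z} - C)"
  by auto

lemma frag_split:
  assumes "frag A ({v, u} # rs) ts" "v \<in> V" "v \<notin> A" "nb v = {u, y, z}" "u \<in> A" "y \<notin> A" "z \<notin> A"
  shows "frag (insert v A) ({v, y} # {v, z} # rs) (plays [Split] ts)"
proof -
  have yz: "u \<noteq> y" "u \<noteq> z" "y \<noteq> z" using card_nb[OF assms(2)] assms(4-7) by (auto simp: card_insert_if split: if_splits)
  have inc: "inc v = {{v, u}, {v, y}, {v, z}}" by (rule inc_eq[OF assms(4)])
  have nc: "{v, y} \<notin> cut A" "{v, z} \<notin> cut A" using star_in_cut[OF assms(3)] assms(4,6,7) by auto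
  have d: "distinct [{v, u}, {v, y}, {v, z}]" using yz by (auto simp: doubleton_eq_iff)
  have f: "A \<subseteq> V" "distinct ({v, u} # rs)" "set ({v, u} # rs) = cut A" "realises_all A ({v, u} # rs) ts"
    using assms(1) unfolding frag_def by auto
  have "realises_all (insert v A) ({v, y} # {v, z} # rs) (plays [Split] ts)"
    unfolding plays.simps by (rule realises_all_split[OF f(1) assms(2,3) f(4,3) _ inc d nc]) (use f(2) in simp)
  moreover have "set ({v, y} # {v, z} # rs) = cut (insert v A)"
    unfolding cut_insert[OF assms(3)] inc list.set
    by (rule sym_diff_swap(1)) (use f(2,3) nc in simp_all)
  moreover have "distinct ({v, y} # {v, z} # rs)" using f(2) f(3)[symmetric] nc d by simp
  ultimately show ?thesis using f(1) assms(2) unfolding frag_def by simp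
qed

lemma frag_join:
  assumes "frag A ({v, u} # {v, u'} # rs) ts" "v \<in> V" "v \<notin> A" "nb v = {u, u', z}" "u \<in> A" "u' \<in> A" "z \<notin> A"
  shows "frag (insert v A) ({v, z} # rs) (plays [Join] ts)"
proof -
  have yz: "u \<noteq> u'" "u \<noteq> z" "u' \<noteq> z" using card_nb[OF assms(2)] assms(4-7) by (auto simp: card_insert_if split: if_splits)
  have inc: "inc v = {{v, u}, {v, u'}, {v, z}}" by (rule inc_eq[OF assms(4)])
  have nc: "{v, z} \<notin> cut A" using star_in_cut[OF assms(3)] assms(4,7) by auto
  have d: "distinct [{v, u}, {v, u'}, {v, z}]" using yz by (auto simp: doubleton_eq_iff)
  have f: "A \<subseteq> V" "distinct ({v, u} # {v, u'} # rs)" "set ({v, u} # {v, u'} # rs) = cut A"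
      "realises_all A ({v, u} # {v, u'} # rs) ts"
    using assms(1) unfolding frag_def by auto
  have "realises_all (insert v A) ({v, z} # rs) (plays [Join] ts)"
    unfolding plays.simps by (rule realises_all_join[OF f(1) assms(2,3) f(4,3) _ _ inc d nc]) (use f(2) in simp_all)
  moreover have "set ({v, z} # rs) = cut (insert v A)"
    unfolding cut_insert[OF assms(3)] inc list.set
    by (rule sym_diff_swap(2)) (use f(2,3) nc in simp_all)
  moreover have "distinct ({v, z} # rs)" using f(2) f(3)[symmetric] nc by simp
  ultimately show ?thesis using f(1) assms(2) unfolding frag_def by simp
qed

lemma frag_length: "frag A es ts \<Longrightarrow> length es = card (cut A)"
  unfolding frag_def by (metis distinct_card)

lemma good3E:
  assumes "good A" "card (cut A) = 3"
  obtains es X where "length es = 3" "X \<in> set fam3" "frag A es X"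
  using assms frag_length unfolding good_def by fastforce

lemma good4E:
  assumes "good A" "card (cut A) = 4"
  obtains es X where "length es = 4" "X \<in> set fam4" "frag A es X"
  using assms frag_length unfolding good_def by fastforce

text \<open>From the checked tables to fragments: reorder by the \<open>q\<close> of the table and
  keep only the types of the covered member.\<close>

lemma closes_good:
  assumes cl: "closes Fam Fam' n ms ps" and X: "X \<in> set Fam" "p \<in> set ps"
    and n: "n = 3 \<and> Fam' = fam3 \<or> n = 4 \<and> Fam' = fam4"
    and fr: "frag A es (plays (Perm p # ms) X)" "length es = n"
  shows "good A"
proof -
  obtain Y q where Y: "Y \<in> set Fam'" and q: "distinct q" "set q = {..<n}"
    and c: "covers (plays (Perm p # ms @ [Perm q]) X) Y"
    using cl X unfolding closes_def by blast
  have "frag A (reord q es) (plays [Perm q] (plays (Perm p # ms) X))"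
    by (rule frag_perm[OF fr(1)]) (use q fr(2) in auto)
  then have "frag A (reord q es) (plays (Perm p # ms @ [Perm q]) X)"
    unfolding append_Cons[symmetric] plays_append .
  then have "frag A (reord q es) Y" using realises_all_covers[OF _ c] unfolding frag_def by blast
  moreover have "length (reord q es) = n" using q unfolding reord_def by (metis card_lessThan distinct_card length_map)
  ultimately show ?thesis using n Y unfolding good_def by blast
qed

lemma good_start:
  assumes v: "v \<in> V"
  shows "good {v}"
proof -
  obtain x y z where xyz: "inc v = {x, y, z}" "distinct [x, y, z]"
    using card_inc[OF v] by (auto simp: card_3_iff)
  have s: "sol {} f" for f
  proof -
    have "inner_tree {} f = {}" using edge_card unfolding inner_tree_def by fastforce
    then show ?thesis unfolding sol_def acyclic_edges_def is_cycle_def by auto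
  qed
  have "realises {v} [x, y, z] t" if "t \<in> set (hd fam3)" for t
  proof -
    have t: "length t = 3" "ok_star 0 (mset t)" using fam3_hd[OF that] by auto
    \<comment> \<open>The start is an insertion into the empty fragment with no edges back, so any
      labels allowed by \<open>ok_star\<close> will do.\<close>
    have "realises (insert v {}) ([x, y, z] @ []) (t @ [])"
      by (rule realises_add[where A = "{}" and v = v and xs = "[]" and rs = "[]" and tx = "[]" and tr = "[]"
            and ys = "[x, y, z]" and ty = t and m = 0 and K = "{}" and tr' = "[]"])
        (use v s xyz t ok_star_Tr[OF t(2), of 0] in \<open>auto simp: realises_def\<close>)
    then show ?thesis by simp
  qed
  moreover have "cut {v} = {x, y, z}" using cut_insert[of v "{}"] xyz by simp
  ultimately have "frag {v} [x, y, z] (hd fam3)"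
    using v xyz unfolding frag_def realises_all_def by auto
  moreover have "hd fam3 \<in> set fam3" by (simp add: fam3_def)
  ultimately show ?thesis unfolding good_def by (intro exI[of _ "[x, y, z]"]) auto
qed

text \<open>The last vertex brings no new edges, so labels are only renamed. Every component shows
  itself on the three cut edges, all of which end at \<open>v\<close>; fusing all names in
  \<open>K\<close> therefore leaves one component.\<close>

lemma good_final:
  assumes "good A" "v \<notin> A" "V = insert v A"
  shows "three_decomposition V E"
proof -
  have AV: "A \<subseteq> V" "v \<in> V" using assms by auto
  have "A = V - {v}" using assms by auto
  then have cut: "cut A = inc v" using cut_compl[of "{v}"] cut_insert[of v "{}"] AV by simp
  then have "card (cut A) = 3" using card_inc AV by simp
  with assms(1) obtain es X where es: "length es = 3" "X \<in> set fam3" "frag A es X" by (rule good3E)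
  obtain t where t: "t \<in> set X" "final t" using fam3_final es(2) by blast
  then obtain f where f: "sol A f" "t = map f es" "\<forall>u\<in>A. \<forall>a\<in>cols f u. Tr a \<in> set t"
    using es(3) unfolding frag_def realises_all_def realises_def by blast
  have se: "set es = cut A" "distinct es" using es(3) unfolding frag_def by auto
  define K where "K = {a. Tr a \<in> set t}"
  obtain m where m: "m \<in> K" "ok_star m (mset (map (relabel (merge K m)) t))"
    using final_ok_star(1)[OF t(2) K_def] by blast
  let ?f = "relabel (merge K m) \<circ> f"
  have ci: "cut A \<inter> inc v = set es" using se cut by simp
  have Kf: "K = {a. \<exists>e\<in>cut A \<inter> inc v. f e = Tr a}" unfolding ci K_def f(2) by (auto simp: image_iff eq_commute)
  have inj: "e = e'" if e: "e \<in> cut A \<inter> inc v" "e' \<in> cut A \<inter> inc v" "f e = Tr a" "f e' = Tr a" for e e' a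
  proof -
    obtain i j where "i < length es" "e = es ! i" "j < length es" "e' = es ! j"
      using e(1,2) unfolding ci by (auto simp: in_set_conv_nth)
    then show ?thesis using final_ok_star(3)[OF t(2) K_def, of i j a] e(3,4) f(2) by simp
  qed
  have "mset_set (inc v) = mset es" using se cut mset_set_set by metis
  then have ok: "ok_star m (image_mset ?f (mset_set (inc v)))"
    using m(2) unfolding f(2) by (simp add: multiset.map_comp)
  have mK: "m \<in> K \<or> (\<forall>u\<in>A. m \<notin> cols f u)" using m by simp
  have f': "?f e = relabel (merge K m) (f e)" if "e \<in> E" "e \<inter> A \<noteq> {}" for e by simp
  note si = sol_insert[OF AV assms(2) f(1) Kf _ mK _ ok]
  have "sol (insert v A) ?f" by (rule si(1)) (use inj in auto)
  moreover have "cols ?f u = {m}" if "u \<in> V" for u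
  proof (cases "u = v")
    case True
    show ?thesis unfolding True by (rule si(3)) (use inj in auto)
  next
    case False
    then have uA: "u \<in> A" using that assms(3) by simp
    obtain a where "ok_star a (image_mset f (mset_set (inc u)))" using f(1) uA unfolding sol_def by blast
    then have a: "cols f u = {a}" by (rule ok_star_cols)
    then have "a \<in> K" using f(3) uA unfolding K_def by auto
    moreover have "cols ?f u = merge K m ` cols f u" by (rule si(2)[OF _ _ uA]) (use inj in auto)
    ultimately show ?thesis using a unfolding merge_def by simp
  qed
  ultimately show ?thesis using sol_decomposition assms(3) by blast
qed

lemma good_split:
  assumes A: "good A" "card (cut A) = 3" and v: "v \<in> V" "v \<notin> A" "nb v = {u, y, z}" "u \<in> A" "y \<notin> A" "z \<notin> A"
  shows "good (insert v A)"
proof -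
  obtain es X where es: "length es = 3" "X \<in> set fam3" "frag A es X" using A by (rule good3E)
  have "{v, u} \<in> set es" using es(3) star_in_cut v unfolding frag_def by auto
  then obtain p c d where p: "p \<in> set singles3" "reord p es = [{v, u}, c, d]"
    using singles3_reord[OF es(1)] by blast
  have "frag A [{v, u}, c, d] (plays [Perm p] X)"
    using frag_perm[OF es(3), of p] perms_reord(1)[OF p(1)] es(1) p(2) by simp
  from frag_split[OF this v]
  have "frag (insert v A) [{v, y}, {v, z}, c, d] (plays (Perm p # [Split]) X)" by simp
  then show ?thesis by (rule closes_good[OF closes_split es(2) p(1), rotated]) auto
qed

lemma good_join:
  assumes A: "good A" "card (cut A) = 4" and v: "v \<in> V" "v \<notin> A" "nb v = {u, u', z}" "u \<in> A" "u' \<in> A" "z \<notin> A"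
  shows "good (insert v A)"
proof -
  obtain es X where es: "length es = 4" "X \<in> set fam4" "frag A es X" using A by (rule good4E)
  have uu: "u \<noteq> u'" using card_nb[OF v(1)] v(3-6) by (auto simp: card_insert_if split: if_splits)
  have "{v, u} \<in> set es" "{v, u'} \<in> set es" "{v, u} \<noteq> {v, u'}"
    using es(3) star_in_cut v uu unfolding frag_def by (auto simp: doubleton_eq_iff)
  then obtain p c d where p: "p \<in> set pairs4"
      and r: "reord p es = [{v, u}, {v, u'}, c, d] \<or> reord p es = [{v, u'}, {v, u}, c, d]"
    using pairs4_reord[OF es(1)] by blast
  have fr: "frag A (reord p es) (plays [Perm p] X)"
    using frag_perm[OF es(3), of p] perms_reord(2)[OF p] es(1) by simp
  have "frag (insert v A) [{v, z}, c, d] (plays (Perm p # [Join]) X)"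
    using r
  proof
    assume "reord p es = [{v, u}, {v, u'}, c, d]"
    then show ?thesis using frag_join[of A v u u' "[c, d]", OF _ v] fr by simp
  next
    assume "reord p es = [{v, u'}, {v, u}, c, d]"
    moreover have "nb v = {u', u, z}" using v(3) by auto
    ultimately show ?thesis using frag_join[of A v u' u "[c, d]", OF _ v(1,2) _ v(5,4,6)] fr by simp
  qed
  then show ?thesis by (rule closes_good[OF closes_join es(2) p(1), rotated]) auto
qed

lemma cut_edges_in:
  assumes "frag A es X" "v \<notin> A" "v' \<notin> A" "u \<in> nb v" "u' \<in> nb v'" "u \<in> A" "u' \<in> A" "v \<noteq> v'"
  shows "{v, u} \<in> set es" "{v', u'} \<in> set es" "{v, u} \<noteq> {v', u'}"
  using assms star_in_cut unfolding frag_def by (auto simp: doubleton_eq_iff)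

lemma frag_reord:
  assumes "frag A es ts" "distinct p \<and> set p = {..<length es}" "reord p es = es'"
  shows "frag A es' (plays [Perm p] ts)"
  using frag_perm assms by blast

section \<open>Rung, square, triangle and claw\<close>

lemma frag_rung:
  assumes "frag A [{a, u}, {b, w}, c, d] ts" "a \<in> V" "b \<in> V" "a \<notin> A" "b \<notin> A" "u \<in> A" "w \<in> A"
    "nb a = {u, b, a'}" "nb b = {w, a, b'}" "a' \<notin> A" "b' \<notin> insert a A"
  shows "frag (insert b (insert a A)) [{b, b'}, {a, a'}, c, d] (plays [Split, Perm [1,2,0,3,4], Join] ts)"
proof -
  have ab: "a \<noteq> b" using assms(8) nb_irrefl[of a] by auto
  have "frag (insert a A) [{a, a'}, {a, b}, {b, w}, c, d] (plays [Split] ts)"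
    by (rule frag_split[where u = u]) (use assms in auto)
  then have "frag (insert a A) [{b, a}, {b, w}, {a, a'}, c, d] (plays [Perm [1,2,0,3,4]] (plays [Split] ts))"
    by (rule frag_reord) (auto simp: reord_def insert_commute)
  then have "frag (insert b (insert a A)) [{b, b'}, {a, a'}, c, d] (plays [Join] (plays [Perm [1,2,0,3,4]] (plays [Split] ts)))"
    by (rule frag_join) (use assms ab in auto)
  then show ?thesis by simp
qed

lemma frag_square:
  assumes "frag A [{a, u}, {b, w}, s, t] ts" "{a, b, c, d} \<subseteq> V" "{a, b, c, d} \<inter> A = {}" "distinct [a, b, c, d]"
    "u \<in> A" "w \<in> A"
    "nb a = {u, c, d}" "nb b = {w, c, d}" "nb c = {a, b, c'}" "nb d = {a, b, d'}"
    "c' \<notin> A \<union> {a, b, c, d}" "d' \<notin> A \<union> {a, b, c, d}"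
  shows "frag (A \<union> {a, b, c, d}) [{d, d'}, {c, c'}, s, t]
    (plays [Split, Perm [2,0,1,3,4], Split, Perm [0,2,1,3,4,5], Join, Perm [1,2,0,3,4], Join] ts)"
proof -
  let ?A1 = "insert a A" let ?A2 = "insert b ?A1" let ?A3 = "insert c ?A2" let ?A4 = "insert d ?A3"
  have "frag ?A1 [{a, c}, {a, d}, {b, w}, s, t] (plays [Split] ts)" (is "frag _ _ ?t1")
    by (rule frag_split[where u = u]) (use assms in auto)
  then have "frag ?A1 [{b, w}, {a, c}, {a, d}, s, t] (plays [Perm [2,0,1,3,4]] ?t1)" (is "frag _ _ ?t2")
    by (rule frag_reord) (auto simp: reord_def)
  then have "frag ?A2 [{b, c}, {b, d}, {a, c}, {a, d}, s, t] (plays [Split] ?t2)" (is "frag _ _ ?t3")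
    by (rule frag_split[where u = w]) (use assms in auto)
  then have "frag ?A2 [{c, b}, {c, a}, {d, b}, {d, a}, s, t] (plays [Perm [0,2,1,3,4,5]] ?t3)" (is "frag _ _ ?t4")
    by (rule frag_reord) (auto simp: reord_def insert_commute)
  then have "frag ?A3 [{c, c'}, {d, b}, {d, a}, s, t] (plays [Join] ?t4)" (is "frag _ _ ?t5")
    by (rule frag_join) (use assms in auto)
  then have "frag ?A3 [{d, b}, {d, a}, {c, c'}, s, t] (plays [Perm [1,2,0,3,4]] ?t5)" (is "frag _ _ ?t6")
    by (rule frag_reord) (auto simp: reord_def)
  then have "frag ?A4 [{d, d'}, {c, c'}, s, t] (plays [Join] ?t6)"
    by (rule frag_join) (use assms in auto)
  moreover have "?A4 = A \<union> {a, b, c, d}" by auto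
  ultimately show ?thesis by simp
qed

lemma frag_triangle:
  assumes "frag A [{a, u}, {b, w}, s, t] ts" "{a, b, c, d} \<subseteq> V" "{a, b, c, d} \<inter> A = {}" "distinct [a, b, c, d]"
    "u \<in> A" "w \<in> A"
    "nb a = {u, c, d}" "nb b = {w, c, b'}" "nb c = {a, b, d}" "nb d = {a, c, d'}"
    "b' \<notin> A \<union> {a, b, c, d}" "d' \<notin> A \<union> {a, b, c, d}"
  shows "frag (A \<union> {a, b, c, d}) [{d, d'}, {b, b'}, s, t]
    (plays [Split, Perm [2,0,1,3,4], Split, Perm [2,0,3,1,4,5], Join, Join] ts)"
proof -
  let ?A1 = "insert a A" let ?A2 = "insert b ?A1" let ?A3 = "insert c ?A2" let ?A4 = "insert d ?A3"
  have "frag ?A1 [{a, c}, {a, d}, {b, w}, s, t] (plays [Split] ts)" (is "frag _ _ ?t1")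
    by (rule frag_split[where u = u]) (use assms in auto)
  then have "frag ?A1 [{b, w}, {a, c}, {a, d}, s, t] (plays [Perm [2,0,1,3,4]] ?t1)" (is "frag _ _ ?t2")
    by (rule frag_reord) (auto simp: reord_def)
  then have "frag ?A2 [{b, c}, {b, b'}, {a, c}, {a, d}, s, t] (plays [Split] ?t2)" (is "frag _ _ ?t3")
    by (rule frag_split[where u = w]) (use assms in auto)
  then have "frag ?A2 [{c, a}, {c, b}, {d, a}, {b, b'}, s, t] (plays [Perm [2,0,3,1,4,5]] ?t3)" (is "frag _ _ ?t4")
    by (rule frag_reord) (auto simp: reord_def insert_commute)
  then have "frag ?A3 [{c, d}, {d, a}, {b, b'}, s, t] (plays [Join] ?t4)" (is "frag _ _ ?t5")
    by (rule frag_join) (use assms in auto)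
  then have "frag ?A3 [{d, c}, {d, a}, {b, b'}, s, t] ?t5" by (simp add: insert_commute)
  then have "frag ?A4 [{d, d'}, {b, b'}, s, t] (plays [Join] ?t5)"
    by (rule frag_join) (use assms in auto)
  moreover have "?A4 = A \<union> {a, b, c, d}" by auto
  ultimately show ?thesis by simp
qed

lemma frag_claw:
  assumes "frag A [{a, u}, {b, w}, {c, x}, s] ts" "{a, b, c, d} \<subseteq> V" "{a, b, c, d} \<inter> A = {}" "distinct [a, b, c, d]"
    "u \<in> A" "w \<in> A" "x \<in> A"
    "nb a = {u, d, a'}" "nb b = {w, d, b'}" "nb c = {x, d, c'}" "nb d = {a, b, c}"
    "a' \<notin> A \<union> {a, b, c, d}" "b' \<notin> A \<union> {a, b, c, d}" "c' \<notin> A \<union> {a, b, c, d}"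
  shows "frag (A \<union> {a, b, c, d}) [{c, c'}, {a, a'}, {b, b'}, s]
    (plays [Split, Perm [2,0,1,3,4], Split, Perm [2,0,3,1,4,5], Join, Perm [0,3,1,2,4], Join] ts)"
proof -
  \<comment> \<open>The centre \<open>d\<close> precedes the leaf \<open>c\<close>. Coming last it
    would have three edges back into the fragment, and no move covers that.\<close>
  let ?A1 = "insert a A" let ?A2 = "insert b ?A1" let ?A3 = "insert d ?A2" let ?A4 = "insert c ?A3"
  have "frag ?A1 [{a, d}, {a, a'}, {b, w}, {c, x}, s] (plays [Split] ts)" (is "frag _ _ ?t1")
    by (rule frag_split[where u = u]) (use assms in auto)
  then have "frag ?A1 [{b, w}, {a, d}, {a, a'}, {c, x}, s] (plays [Perm [2,0,1,3,4]] ?t1)" (is "frag _ _ ?t2")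
    by (rule frag_reord) (auto simp: reord_def)
  then have "frag ?A2 [{b, d}, {b, b'}, {a, d}, {a, a'}, {c, x}, s] (plays [Split] ?t2)" (is "frag _ _ ?t3")
    by (rule frag_split[where u = w]) (use assms in auto)
  then have "frag ?A2 [{d, a}, {d, b}, {a, a'}, {b, b'}, {c, x}, s] (plays [Perm [2,0,3,1,4,5]] ?t3)" (is "frag _ _ ?t4")
    by (rule frag_reord) (auto simp: reord_def insert_commute)
  then have "frag ?A3 [{d, c}, {a, a'}, {b, b'}, {c, x}, s] (plays [Join] ?t4)" (is "frag _ _ ?t5")
    by (rule frag_join) (use assms in auto)
  then have "frag ?A3 [{c, d}, {c, x}, {a, a'}, {b, b'}, s] (plays [Perm [0,3,1,2,4]] ?t5)" (is "frag _ _ ?t6")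
    by (rule frag_reord) (auto simp: reord_def insert_commute)
  then have "frag ?A4 [{c, c'}, {a, a'}, {b, b'}, s] (plays [Join] ?t6)"
    by (rule frag_join) (use assms in auto)
  moreover have "?A4 = A \<union> {a, b, c, d}" by auto
  ultimately show ?thesis by simp
qed

lemma good_rung:
  assumes A: "good A" "card (cut A) = 4"
    and g: "a \<in> V" "b \<in> V" "a \<notin> A" "b \<notin> A" "u \<in> A" "w \<in> A"
      "nb a = {u, b, a'}" "nb b = {w, a, b'}" "a' \<notin> A" "b' \<notin> insert a A"
  shows "good (insert b (insert a A))"
proof -
  obtain es X where es: "length es = 4" "X \<in> set fam4" "frag A es X" using A by (rule good4E)
  have ab: "a \<noteq> b" using g(7) nb_irrefl[of a] by auto
  have a'b: "a' \<notin> insert b A" using card_nb[OF g(1)] g by (auto simp: card_insert_if split: if_splits)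
  have "{a, u} \<in> set es" "{b, w} \<in> set es" "{a, u} \<noteq> {b, w}"
    by (rule cut_edges_in[OF es(3), of a b u w]; use g ab in simp)+
  then obtain p c d where p: "p \<in> set pairs4"
      and r: "reord p es = [{a, u}, {b, w}, c, d] \<or> reord p es = [{b, w}, {a, u}, c, d]"
    using pairs4_reord[OF es(1)] by blast
  have fr: "frag A (reord p es) (plays [Perm p] X)"
    using frag_perm[OF es(3), of p] perms_reord(2)[OF p] es(1) by simp
  let ?ms = "[Split, Perm [1,2,0,3,4], Join]"
  \<comment> \<open>\<open>pairs4_reord\<close> gives the two edges only up to order; the second
    case is the first with the ends of the rung exchanged.\<close>
  from r have "\<exists>es'. length es' = 4 \<and> frag (insert b (insert a A)) es' (plays (Perm p # ?ms) X)"
  proof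
    assume "reord p es = [{a, u}, {b, w}, c, d]"
    then have "frag (insert b (insert a A)) [{b, b'}, {a, a'}, c, d] (plays ?ms (plays [Perm p] X))"
      by (intro frag_rung) (use fr g in auto)
    then show ?thesis by (intro exI[of _ "[{b, b'}, {a, a'}, c, d]"]) simp
  next
    assume "reord p es = [{b, w}, {a, u}, c, d]"
    then have "frag (insert a (insert b A)) [{a, a'}, {b, b'}, c, d] (plays ?ms (plays [Perm p] X))"
      by (intro frag_rung) (use fr g a'b in auto)
    then show ?thesis by (intro exI[of _ "[{a, a'}, {b, b'}, c, d]"]) (simp add: insert_commute)
  qed
  then show ?thesis using closes_good[OF closes_rung es(2) p] by blast
qed

lemma nb_one:
  assumes "v \<in> V" "card (nb v \<inter> A) = 1" "w \<in> nb v" "w \<notin> A"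
  shows "\<exists>u z. nb v = {u, w, z} \<and> u \<in> A \<and> z \<notin> A \<and> z \<noteq> w"
proof -
  obtain u where u: "nb v \<inter> A = {u}" using assms(2) by (rule card_1_singletonE)
  have uw: "{u, w} \<subseteq> nb v" "u \<in> A" "u \<noteq> w" using u assms(3,4) by blast+
  have "card (nb v - {u, w}) = 1"
    using card_Diff_subset[OF _ uw(1)] card_nb[OF assms(1)] uw(3) by simp
  then obtain z where z: "nb v - {u, w} = {z}" by (rule card_1_singletonE)
  have "nb v = {u, w, z}" "z \<noteq> w" "z \<notin> A" using uw z u by blast+
  then show ?thesis using uw(2) by blast
qed

lemma nb_two:
  assumes "v \<in> V" "x \<in> nb v" "y \<in> nb v" "x \<noteq> y"
  shows "\<exists>z. nb v = {x, y, z} \<and> z \<noteq> x \<and> z \<noteq> y"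
proof -
  have xy: "{x, y} \<subseteq> nb v" using assms(2,3) by blast
  have "card (nb v - {x, y}) = 1"
    using card_Diff_subset[OF _ xy] card_nb[OF assms(1)] assms(4) by simp
  then obtain z where z: "nb v - {x, y} = {z}" by (rule card_1_singletonE)
  have "nb v = {x, y, z}" "z \<noteq> x" "z \<noteq> y" using xy z by blast+
  then show ?thesis by blast
qed

lemma nb_three:
  assumes "v \<in> V" "x \<in> nb v" "y \<in> nb v" "z \<in> nb v" "x \<noteq> y" "x \<noteq> z" "y \<noteq> z"
  shows "nb v = {x, y, z}"
proof -
  obtain w where w: "nb v = {x, y, w}" using nb_two[OF assms(1-3,5)] by (elim exE conjE)
  then have "z = w" using assms(4,6,7) by simp
  then show ?thesis using w by simp
qed

lemma good_square:
  assumes A: "good A" "card (cut A) = 4"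
    and g: "{a, b, c, d} \<subseteq> V" "{a, b, c, d} \<inter> A = {}" "distinct [a, b, c, d]"
    and A1: "card (nb a \<inter> A) = 1" "card (nb b \<inter> A) = 1" and A0: "nb c \<inter> A = {}" "nb d \<inter> A = {}"
    and adj: "c \<in> nb a" "d \<in> nb a" "c \<in> nb b" "d \<in> nb b" and nadj: "d \<notin> nb c"
  shows "good (A \<union> {a, b, c, d})"
proof -
  obtain es X where es: "length es = 4" "X \<in> set fam4" "frag A es X" using A by (rule good4E)
  obtain u where u: "nb a = {u, c, d}" "u \<in> A" using nb_one[of a A c] g A1 adj by auto
  obtain w where w: "nb b = {w, c, d}" "w \<in> A" using nb_one[of b A c] g A1 adj by auto
  obtain c' where c: "nb c = {a, b, c'}" "c' \<noteq> a" "c' \<noteq> b"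
    using nb_two[of c a b] g adj nb_sym by auto
  obtain d' where d: "nb d = {a, b, d'}" "d' \<noteq> a" "d' \<noteq> b"
    using nb_two[of d a b] g adj nb_sym by auto
  have c': "c' \<notin> A \<union> {a, b, c, d}" using c A0 nadj nb_irrefl[of c] by auto
  have "c \<notin> nb d" using nadj nb_sym by blast
  then have d': "d' \<notin> A \<union> {a, b, c, d}" using d A0 nb_irrefl[of d] by auto
  have "{a, u} \<in> set es" "{b, w} \<in> set es" "{a, u} \<noteq> {b, w}"
    by (rule cut_edges_in[OF es(3), of a b u w]; use g u w in simp)+
  then obtain p s t where p: "p \<in> set pairs4"
      and r: "reord p es = [{a, u}, {b, w}, s, t] \<or> reord p es = [{b, w}, {a, u}, s, t]"
    using pairs4_reord[OF es(1)] by blast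
  have fr: "frag A (reord p es) (plays [Perm p] X)"
    using frag_perm[OF es(3), of p] perms_reord(2)[OF p] es(1) by simp
  let ?ms = "[Split, Perm [2,0,1,3,4], Split, Perm [0,2,1,3,4,5], Join, Perm [1,2,0,3,4], Join]"
  from r have "frag (A \<union> {a, b, c, d}) [{d, d'}, {c, c'}, s, t] (plays ?ms (plays [Perm p] X))"
  proof
    assume "reord p es = [{a, u}, {b, w}, s, t]"
    then show ?thesis using fr by (intro frag_square[OF _ g u(2) w(2) u(1) w(1) c(1) d(1) c' d']) simp
  next
    assume r: "reord p es = [{b, w}, {a, u}, s, t]"
    \<comment> \<open>Exchanging \<open>a\<close> and \<open>b\<close> maps the square to itself and
      fixes \<open>c\<close> and \<open>d\<close>, so both cases end with the same list of cut
      edges.\<close>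
    have e: "{b, a, c, d} = {a, b, c, d}" by auto
    have "frag (A \<union> {b, a, c, d}) [{d, d'}, {c, c'}, s, t] (plays ?ms (plays [Perm p] X))"
      by (rule frag_square[where u = w and w = u]) (use fr r g u w c d c' d' e in auto)
    then show ?thesis unfolding e .
  qed
  then have "frag (A \<union> {a, b, c, d}) [{d, d'}, {c, c'}, s, t] (plays (Perm p # ?ms) X)" by simp
  then show ?thesis by (rule closes_good[OF closes_square es(2) p, rotated]) auto
qed

lemma good_triangle:
  assumes A: "good A" "card (cut A) = 4"
    and g: "{a, b, c, d} \<subseteq> V" "{a, b, c, d} \<inter> A = {}" "distinct [a, b, c, d]"
    and A1: "card (nb a \<inter> A) = 1" "card (nb b \<inter> A) = 1" and A0: "nb c \<inter> A = {}" "nb d \<inter> A = {}"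
    and adj: "c \<in> nb a" "d \<in> nb a" "c \<in> nb b" "d \<in> nb c" and nadj: "d \<notin> nb b"
  shows "good (A \<union> {a, b, c, d})"
proof -
  obtain es X where es: "length es = 4" "X \<in> set fam4" "frag A es X" using A by (rule good4E)
  obtain u where u: "nb a = {u, c, d}" "u \<in> A" using nb_one[of a A c] g A1 adj by auto
  obtain w b' where w: "nb b = {w, c, b'}" "w \<in> A" "b' \<notin> A" "b' \<noteq> c" using nb_one[of b A c] g A1 adj by auto
  have c: "nb c = {a, b, d}" by (rule nb_three) (use g adj nb_sym in auto)
  obtain d' where d: "nb d = {a, c, d'}" "d' \<noteq> a" "d' \<noteq> c"
    using nb_two[of d a c] g adj nb_sym by auto
  have "b \<notin> nb a" using u g by auto
  then have "a \<notin> nb b" using nb_sym by blast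
  then have b': "b' \<notin> A \<union> {a, b, c, d}" using w nadj nb_irrefl[of b] by auto
  have "b \<notin> nb d" using nadj nb_sym by blast
  then have d': "d' \<notin> A \<union> {a, b, c, d}" using d A0 nb_irrefl[of d] by auto
  have "{a, u} \<in> set es" "{b, w} \<in> set es" "{a, u} \<noteq> {b, w}"
    by (rule cut_edges_in[OF es(3), of a b u w]; use g u w in simp)+
  then obtain p s t where p: "p \<in> set ordered_pairs4" and r: "reord p es = [{a, u}, {b, w}, s, t]"
    using ordered_pairs4_reord[OF es(1)] by blast
  have fr: "frag A [{a, u}, {b, w}, s, t] (plays [Perm p] X)"
    using frag_perm[OF es(3), of p] perms_reord(3)[OF p] es(1) r by simp
  have "frag (A \<union> {a, b, c, d}) [{d, d'}, {b, b'}, s, t]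
    (plays (Perm p # [Split, Perm [2,0,1,3,4], Split, Perm [2,0,3,1,4,5], Join, Join]) X)"
    using frag_triangle[OF fr g u(2) w(2) u(1) w(1) c d(1) b' d'] by simp
  then show ?thesis by (rule closes_good[OF closes_triangle es(2) p, rotated]) auto
qed

lemma good_claw:
  assumes A: "good A" "card (cut A) = 4"
    and g: "{a, b, c, d} \<subseteq> V" "{a, b, c, d} \<inter> A = {}" "distinct [a, b, c, d]"
    and A1: "card (nb a \<inter> A) = 1" "card (nb b \<inter> A) = 1" "card (nb c \<inter> A) = 1"
    and adj: "d \<in> nb a" "d \<in> nb b" "d \<in> nb c" and nadj: "b \<notin> nb a" "c \<notin> nb a" "c \<notin> nb b"
  shows "good (A \<union> {a, b, c, d})"
proof -
  obtain es X where es: "length es = 4" "X \<in> set fam4" "frag A es X" using A by (rule good4E)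
  let ?ms = "[Split, Perm [2,0,1,3,4], Split, Perm [2,0,3,1,4,5], Join, Perm [0,3,1,2,4], Join]"
  let ?B = "A \<union> {a, b, c, d}"
  have nadj': "a \<notin> nb b" "a \<notin> nb c" "b \<notin> nb c" using nadj nb_sym by blast+
  obtain u a' where u: "nb a = {u, d, a'}" "u \<in> A" "a' \<notin> A" "a' \<noteq> d" using nb_one[of a A d] g A1 adj by auto
  obtain w b' where w: "nb b = {w, d, b'}" "w \<in> A" "b' \<notin> A" "b' \<noteq> d" using nb_one[of b A d] g A1 adj by auto
  obtain x c' where x: "nb c = {x, d, c'}" "x \<in> A" "c' \<notin> A" "c' \<noteq> d" using nb_one[of c A d] g A1 adj by auto
  have d: "nb d = {a, b, c}" by (rule nb_three) (use g adj nb_sym in auto)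
  have a': "a' \<notin> ?B" using u nadj nb_irrefl[of a] by auto
  have b': "b' \<notin> ?B" using w nadj nadj' nb_irrefl[of b] by auto
  have c': "c' \<notin> ?B" using x nadj' nb_irrefl[of c] by auto
  note ab = cut_edges_in[OF es(3), of a b u w] and ac = cut_edges_in[OF es(3), of a c u x]
    and bc = cut_edges_in[OF es(3), of b c w x]
  have m: "{a, u} \<in> set es" "{b, w} \<in> set es" "{c, x} \<in> set es"
    by (rule ab(1); use g u w in simp) (rule ab(2) ac(2); use g u w x in simp)+
  have ne: "{a, u} \<noteq> {b, w}" "{a, u} \<noteq> {c, x}" "{b, w} \<noteq> {c, x}"
    by (rule ab(3) ac(3) bc(3); use g u w x in simp)+
  obtain p s where p: "p \<in> set triples4" and r: "reord p es \<in> {[{a, u}, {b, w}, {c, x}, s],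
      [{a, u}, {c, x}, {b, w}, s], [{b, w}, {a, u}, {c, x}, s], [{b, w}, {c, x}, {a, u}, s],
      [{c, x}, {a, u}, {b, w}, s], [{c, x}, {b, w}, {a, u}, s]}"
    using triples4_reord[OF es(1) m ne] by (elim bexE exE)
  have fr: "frag A (reord p es) (plays [Perm p] X)"
    using frag_perm[OF es(3), of p] perms_reord(4)[OF p] es(1) by simp
  \<comment> \<open>Bundles what is known of a leaf, so that one argument, \<open>claw\<close>,
    serves all six orders.\<close>
  define attached where "attached v y v' \<longleftrightarrow> v \<in> V \<and> v \<notin> A \<and> v \<noteq> d \<and> y \<in> A \<and> nb v = {y, d, v'} \<and> v' \<notin> ?B"
    for v y v'
  have att: "attached a u a'" "attached b w b'" "attached c x c'"
    unfolding attached_def using g u w x a' b' c' by auto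
  have claw: "\<exists>es'. length es' = 4 \<and> frag ?B es' (plays ?ms (plays [Perm p] X))"
    if r: "reord p es = [{i, y}, {j, y'}, {k, y''}, s]" and abc: "{i, j, k} = {a, b, c}" "distinct [i, j, k]"
      and att: "attached i y i'" "attached j y' j'" "attached k y'' k'" for i y j y' k y'' i' j' k'
  proof -
    have B: "?B = A \<union> {i, j, k, d}" using abc(1) by auto
    have "frag (A \<union> {i, j, k, d}) [{k, k'}, {i, i'}, {j, j'}, s] (plays ?ms (plays [Perm p] X))"
    proof (rule frag_claw[where u = y and w = y' and x = y''])
      show "frag A [{i, y}, {j, y'}, {k, y''}, s] (plays [Perm p] X)" using fr r by simp
      show "nb d = {i, j, k}" using d abc(1) by simp
    qed (use att abc(2) g in \<open>unfold attached_def B, auto\<close>)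
    then show ?thesis unfolding B by (intro exI[of _ "[{k, k'}, {i, i'}, {j, j'}, s]"]) simp
  qed
  have dist: "a \<noteq> b" "a \<noteq> c" "b \<noteq> c" using g(3) by auto
  have "\<exists>es'. length es' = 4 \<and> frag ?B es' (plays ?ms (plays [Perm p] X))"
    using r
  proof (elim insertE emptyE)
    assume "reord p es = [{a, u}, {b, w}, {c, x}, s]"
    then show ?thesis by (rule claw) (use att dist in auto)
  next
    assume "reord p es = [{a, u}, {c, x}, {b, w}, s]"
    then show ?thesis by (rule claw) (use att dist in auto)
  next
    assume "reord p es = [{b, w}, {a, u}, {c, x}, s]"
    then show ?thesis by (rule claw) (use att dist in auto)
  next
    assume "reord p es = [{b, w}, {c, x}, {a, u}, s]"
    then show ?thesis by (rule claw) (use att dist in auto)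
  next
    assume "reord p es = [{c, x}, {a, u}, {b, w}, s]"
    then show ?thesis by (rule claw) (use att dist in auto)
  next
    assume "reord p es = [{c, x}, {b, w}, {a, u}, s]"
    then show ?thesis by (rule claw) (use att dist in auto)
  qed
  then show ?thesis using closes_good[OF closes_claw es(2) p] by (metis plays.simps)
qed

section \<open>Counting edges in irreducible steps\<close>

definition adj :: "'a \<Rightarrow> 'a \<Rightarrow> nat" where
  "adj v w = (if w \<in> nb v then 1 else 0)"

lemma adj_sym: "adj v w = adj w v"
  unfolding adj_def by (simp only: nb_sym[of w v])

lemma adj_iff: "adj v w = 1 \<longleftrightarrow> w \<in> nb v" "adj v w = 0 \<longleftrightarrow> w \<notin> nb v"
  unfolding adj_def by simp_all

lemma card_nb_insert: "w \<notin> A \<Longrightarrow> card (nb v \<inter> insert w A) = card (nb v \<inter> A) + adj v w"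
  unfolding adj_def by (simp add: Int_insert_right)

text \<open>Each vertex brings three, each edge inside the quadruple or back to \<open>A\<close>
  takes away two. With \<open>A\<close> empty this bounds the number of inner edges.\<close>

lemma card_cut_four:
  assumes "{p, q, r, s} \<subseteq> V" "{p, q, r, s} \<inter> A = {}" "distinct [p, q, r, s]"
  shows "card (cut (A \<union> {p, q, r, s})) + 2 * (card (nb p \<inter> A) + card (nb q \<inter> A) + card (nb r \<inter> A) + card (nb s \<inter> A)
    + adj p q + adj p r + adj p s + adj q r + adj q s + adj r s) = card (cut A) + 12"
proof -
  let ?A1 = "insert p A" let ?A2 = "insert q ?A1" let ?A3 = "insert r ?A2" let ?A4 = "insert s ?A3"
  have ne: "q \<noteq> p" "r \<noteq> p" "r \<noteq> q" "s \<noteq> p" "s \<noteq> q" "s \<noteq> r" using assms(3) by auto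
  have "card (cut ?A1) + 2 * card (nb p \<inter> A) = card (cut A) + 3"
    by (rule card_cut_insert) (use assms in auto)
  moreover have "card (cut ?A2) + 2 * (card (nb q \<inter> A) + adj p q) = card (cut ?A1) + 3"
    using card_cut_insert[of q ?A1] assms(1,2) ne by (simp add: card_nb_insert adj_sym[of q p])
  moreover have "card (cut ?A3) + 2 * (card (nb r \<inter> A) + adj p r + adj q r) = card (cut ?A2) + 3"
    using card_cut_insert[of r ?A2] assms(1,2) ne by (simp add: card_nb_insert adj_sym[of r p] adj_sym[of r q])
  moreover have "card (cut ?A4) + 2 * (card (nb s \<inter> A) + adj p s + adj q s + adj r s) = card (cut ?A3) + 3"
    using card_cut_insert[of s ?A3] assms(1,2) ne by (simp add: card_nb_insert adj_sym[of s p] adj_sym[of s q] adj_sym[of s r])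
  moreover have "?A4 = A \<union> {p, q, r, s}" by auto
  ultimately show ?thesis by simp
qed

text \<open>Without edges between \<open>A\<close> and \<open>D\<close> their cuts are disjoint and
  both survive in the cut of the union; each has at least 3 edges.\<close>

lemma cut_no_edges:
  assumes con: "k_connected 3 V E" and D: "A \<union> D \<subseteq> V" "A \<noteq> {}" "D \<noteq> {}" "A \<inter> D = {}"
    and no: "\<And>v. v \<in> D \<Longrightarrow> nb v \<inter> A = {}"
  shows "6 \<le> card (cut (A \<union> D))"
proof -
  have "3 \<le> card (cut A)" "3 \<le> card (cut D)"
    by (rule three_edge_connected[OF con]; use D in blast)+
  moreover have "cut A \<inter> cut D = {}" "cut A \<union> cut D \<subseteq> cut (A \<union> D)"
  proof -
    have no': "{x, y} \<notin> E" if "x \<in> A" "y \<in> D" for x y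
      using no[OF that(2)] that(1) unfolding nb_def by (auto simp: insert_commute)
    have e: "e \<notin> cut D \<and> e \<in> cut (A \<union> D)" if "e \<in> cut A" for e
    proof -
      have eE: "e \<in> E" using that unfolding cut_def by simp
      then obtain x y where xy: "e = {x, y}" by (rule edgeE)
      then show ?thesis using that no'[of x y] no'[of y x] eE D(4) unfolding cut_def
        by (auto simp: insert_commute)
    qed
    have e': "e \<in> cut (A \<union> D)" if "e \<in> cut D" for e
    proof -
      have eE: "e \<in> E" using that unfolding cut_def by simp
      then obtain x y where xy: "e = {x, y}" by (rule edgeE)
      then show ?thesis using that no'[of x y] no'[of y x] eE D(4) unfolding cut_def
        by (auto simp: insert_commute)
    qed
    show "cut A \<inter> cut D = {}" "cut A \<union> cut D \<subseteq> cut (A \<union> D)" using e e' by blast+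
  qed
  then have "card (cut A) + card (cut D) \<le> card (cut (A \<union> D))"
    by (metis card_Un_disjoint card_mono finite_cut)
  ultimately show ?thesis by simp
qed

text \<open>The empty set and \<open>V\<close> have empty cuts, so \<open>good\<close> fails there
  and the two ends of the chain need clauses of their own.\<close>

definition settled :: "'a set \<Rightarrow> bool" where
  "settled A \<longleftrightarrow> A = {} \<or> A \<noteq> V \<and> good A \<or> A = V \<and> three_decomposition V E"

text \<open>Here B - A is a single vertex, or a rung, claw, square or triangle: vertices of B - A have at most one
  neighbour in A, those that do are pairwise non-adjacent when B - A has four elements, and counting
  edges leaves no other configuration.\<close>

lemma good_irreducible:
  assumes con: "k_connected 3 V E" and AB: "A \<subset> B" "B \<subset> V" "A \<noteq> {}"
    and small: "card (cut A) \<le> 4" "card (cut B) \<le> 4" "card (B - A) \<le> 5" and A: "good A"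
    and irr: "\<And>C. A \<subset> C \<Longrightarrow> C \<subset> B \<Longrightarrow> 5 \<le> card (cut C)"
  shows "good B"
proof -
  define D where "D = B - A"
  have fin: "finite A" "finite B" "finite D" using AB finite_sub unfolding D_def by blast+
  have D: "D \<subseteq> V" "A \<inter> D = {}" "B = A \<union> D" "D \<noteq> {}" using AB unfolding D_def by auto
  have ge: "3 \<le> card (cut A)" "3 \<le> card (cut B)"
    by (rule three_edge_connected[OF con]; use AB in blast)+
  show ?thesis
  proof (cases "card D = 1")
    case True
    then obtain v where v: "D = {v}" by (rule card_1_singletonE)
    have vA: "v \<in> V" "v \<notin> A" using v D by auto
    have B: "B = insert v A" using v D by simp
    have eq: "card (cut B) + 2 * card (nb v \<inter> A) = card (cut A) + 3"
      unfolding B by (rule card_cut_insert[OF vA])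
    show ?thesis
    proof (cases "card (cut A) = 3")
      case True
      \<comment> \<open>Both cuts have 3 or 4 edges, which fixes the number of neighbours in
        \<open>A\<close>: one if the old cut has 3 edges, two if it has 4.\<close>
      then have "card (nb v \<inter> A) = 1" using eq ge small by linarith
      then obtain u where u: "nb v \<inter> A = {u}" by (rule card_1_singletonE)
      have "nb v \<noteq> {u}" using card_nb[OF vA(1)] by auto
      then obtain w where "w \<in> nb v" "w \<notin> A" using u by blast
      then obtain u z where "nb v = {u, w, z}" "u \<in> A" "z \<notin> A"
        using nb_one[OF vA(1) \<open>card (nb v \<inter> A) = 1\<close>] by blast
      then show ?thesis unfolding B using good_split[OF A True vA _ _ \<open>w \<notin> A\<close>] by blast
    next
      case False
      then have c4: "card (cut A) = 4" using small ge by simp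
      then have "card (nb v \<inter> A) = 2" using eq ge small by presburger
      then obtain u u' where u: "nb v \<inter> A = {u, u'}" "u \<noteq> u'" by (auto simp: card_2_iff)
      then obtain z where z: "nb v = {u, u', z}" "z \<noteq> u" "z \<noteq> u'" using nb_two[OF vA(1), of u u'] by blast
      then have "z \<notin> A" using u by auto
      then show ?thesis unfolding B using good_join[OF A c4 vA z(1)] u by blast
    qed
  next
    case False
    have one: "insert v A \<subset> B" "A \<subset> insert v A" if "v \<in> D" for v
    proof -
      have "D \<noteq> {v}" using False by auto
      then show "insert v A \<subset> B" "A \<subset> insert v A" using that D by auto
    qed
    have b: "5 + 2 * card (nb v \<inter> A) \<le> card (cut A) + 3" if "v \<in> D" for v
    proof -
      have "v \<in> V" "v \<notin> A" using that D by auto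
      then show ?thesis using card_cut_insert[of v A] irr[OF one(2)[OF that] one(1)[OF that]] by simp
    qed
    \<comment> \<open>From a 3-edge cut, adding a single vertex with a neighbour in \<open>A\<close>
      would give at most 4 edges. So irreducibility leaves no edges between \<open>A\<close> and
      \<open>D\<close>, and the cut of \<open>B\<close> gets too large.\<close>
    have a4: "card (cut A) = 4"
    proof (rule ccontr)
      assume "card (cut A) \<noteq> 4"
      then have "card (cut A) = 3" using small ge by linarith
      have "nb v \<inter> A = {}" if "v \<in> D" for v
      proof -
        have "card (nb v \<inter> A) = 0" using b[OF that] \<open>card (cut A) = 3\<close> by linarith
        then show ?thesis by simp
      qed
      then have "6 \<le> card (cut B)" using cut_no_edges[OF con, of A D] D AB by auto
      then show False using small by simp
    qed
    \<comment> \<open>The same argument seen from the complement, removing vertices from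
      \<open>B\<close>.\<close>
    have b4: "card (cut B) = 4"
    proof (rule ccontr)
      assume "card (cut B) \<noteq> 4"
      then have b3: "card (cut B) = 3" using small ge by simp
      have "nb v \<inter> (V - B) = {}" if v: "v \<in> D" for v
      proof -
        have vV: "v \<in> V" "v \<in> B" "v \<notin> A" using v D by auto
        have "A \<subset> B - {v}"
        proof -
          have "D \<noteq> {v}" using False by auto
          then show ?thesis using v D by auto
        qed
        then have "5 \<le> card (cut (B - {v}))" by (rule irr) (use vV in auto)
        moreover have "card (cut B) + 2 * card (nb v \<inter> (B - {v})) = card (cut (B - {v})) + 3"
          using card_cut_insert[of v "B - {v}"] vV by (simp add: insert_absorb)
        ultimately have "card (nb v) \<le> card (nb v \<inter> (B - {v}))" using b3 card_nb[OF vV(1)] by linarith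
        then have "nb v \<inter> (B - {v}) = nb v" by (intro card_seteq) auto
        then show ?thesis by blast
      qed
      then have "6 \<le> card (cut ((V - B) \<union> D))" using cut_no_edges[OF con, of "V - B" D] D AB by auto
      moreover have "(V - B) \<union> D = V - A" using D AB by auto
      moreover have "cut (V - A) = cut A" by (rule cut_compl) (use AB in auto)
      ultimately show False using small by simp
    qed
    have b1: "card (nb v \<inter> A) \<le> 1" if "v \<in> D" for v using b[OF that] a4 by simp
    have "even (card A + card (cut A))" "even (card B + card (cut B))"
      by (rule cut_parity; use AB in blast)+
    moreover have "card B = card A + card D" unfolding D(3) using fin D(2) by (simp add: card_Un_disjoint)
    ultimately have "even (card D)" using a4 b4 by simp
    moreover have "card D \<noteq> 0" "card D \<le> 5" using D(4) fin small(3) unfolding D_def by auto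
    ultimately have "card D = 2 \<or> card D = 4" by presburger
    then show ?thesis
    proof
      assume "card D = 2"
      then obtain a b where ab: "D = {a, b}" "a \<noteq> b" by (auto simp: card_2_iff)
      have aV: "a \<in> V" "b \<in> V" "a \<notin> A" "b \<notin> A" using ab D by auto
      have B: "B = insert b (insert a A)" using ab D by auto
      have "card (cut (insert a A)) + 2 * card (nb a \<inter> A) = card (cut A) + 3"
        by (rule card_cut_insert) (use aV in auto)
      moreover have "card (cut B) + 2 * (card (nb b \<inter> A) + adj b a) = card (cut (insert a A)) + 3"
        using card_cut_insert[of b "insert a A"] aV ab unfolding B by (simp add: card_nb_insert)
      moreover have "card (nb a \<inter> A) \<le> 1" "card (nb b \<inter> A) \<le> 1" using b1 ab by auto
      moreover have "adj b a \<le> 1" unfolding adj_def by simp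
      ultimately have n: "card (nb a \<inter> A) = 1" "card (nb b \<inter> A) = 1" "adj b a = 1" using a4 b4 by simp_all
      then have adj: "a \<in> nb b" "b \<in> nb a" using adj_iff(1)[of b a] adj_iff(1)[of a b] adj_sym[of a b] by simp_all
      obtain u a' where "nb a = {u, b, a'}" "u \<in> A" "a' \<notin> A"
        using nb_one[OF aV(1) n(1) adj(2) aV(4)] by blast
      moreover obtain w b' where "nb b = {w, a, b'}" "w \<in> A" "b' \<notin> A" "b' \<noteq> a"
        using nb_one[OF aV(2) n(2) adj(1) aV(3)] by blast
      ultimately show ?thesis unfolding B using good_rung[OF A a4 aV] by blast
    next
      assume c4: "card D = 4"
      \<comment> \<open>Otherwise \<open>v\<close> and \<open>w\<close> form a rung, and adding it
        gives a 4-edge cut strictly between \<open>A\<close> and \<open>B\<close>.\<close>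
      have indep: "adj v w = 0" if vw: "v \<in> D" "w \<in> D" "v \<noteq> w" "card (nb v \<inter> A) = 1" "card (nb w \<inter> A) = 1" for v w
      proof (rule ccontr)
        assume "adj v w \<noteq> 0"
        then have "adj w v = 1" using adj_sym[of v w] unfolding adj_def by (simp split: if_splits)
        have vV: "v \<in> V" "w \<in> V" "v \<notin> A" "w \<notin> A" using vw D by auto
        let ?C = "insert w (insert v A)"
        have "card (cut (insert v A)) + 2 * card (nb v \<inter> A) = card (cut A) + 3"
          by (rule card_cut_insert) (use vV in auto)
        moreover have "card (cut ?C) + 2 * (card (nb w \<inter> A) + adj w v) = card (cut (insert v A)) + 3"
          using card_cut_insert[of w "insert v A"] vV vw(3) by (simp add: card_nb_insert)
        ultimately have "card (cut ?C) = 4" using vw(4,5) \<open>adj w v = 1\<close> a4 by simp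
        moreover have "D \<noteq> {v, w}" using c4 vw(3) by auto
        then have "?C \<subset> B" "A \<subset> ?C" using D vw vV by auto
        ultimately show False using irr[of ?C] by simp
      qed
      \<comment> \<open>As both cuts have 4 edges, twice the sum is 12. The bound 4 on inner edges
        holds since the cut of \<open>D\<close> itself has at least 3 edges.\<close>
      have four: "card (nb p \<inter> A) + card (nb q \<inter> A) + card (nb r \<inter> A) + card (nb s \<inter> A)
          + adj p q + adj p r + adj p s + adj q r + adj q s + adj r s = 6"
        "adj p q + adj p r + adj p s + adj q r + adj q s + adj r s \<le> 4"
        if d: "D = {p, q, r, s}" "distinct [p, q, r, s]" for p q r s
      proof -
        show "card (nb p \<inter> A) + card (nb q \<inter> A) + card (nb r \<inter> A) + card (nb s \<inter> A)
          + adj p q + adj p r + adj p s + adj q r + adj q s + adj r s = 6"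
          using card_cut_four[of p q r s A] d D a4 b4 by auto
        have "3 \<le> card (cut D)" by (rule three_edge_connected[OF con]) (use D AB in auto)
        then show "adj p q + adj p r + adj p s + adj q r + adj q s + adj r s \<le> 4"
          using card_cut_four[of p q r s "{}"] d D by auto
      qed
      obtain p q r s where pqrs: "D = {p, q, r, s}" "distinct [p, q, r, s]"
      proof -
        obtain xs where "set xs = D" "distinct xs" using finite_distinct_list[OF fin(3)] by blast
        moreover from this have "length xs = 4" using c4 distinct_card by metis
        ultimately show thesis using that by (metis length_4E list.simps(15) list.set(1))
      qed
      \<comment> \<open>At least 6 - 4 = 2 edges lead into \<open>A\<close>, and each vertex of
        \<open>D\<close> has at most one.\<close>
      have "\<exists>a\<in>D. \<exists>a'\<in>D. a \<noteq> a' \<and> card (nb a \<inter> A) = 1 \<and> card (nb a' \<inter> A) = 1"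
      proof (rule ccontr)
        assume n: "\<not> ?thesis"
        have le1: "card (nb v \<inter> A) = 0 \<or> card (nb v \<inter> A) = 1" if "v \<in> D" for v using b1[OF that] by linarith
        have "card (nb p \<inter> A) + card (nb q \<inter> A) + card (nb r \<inter> A) + card (nb s \<inter> A) \<ge> 2"
          using four[OF pqrs] by linarith
        moreover have m: "p \<in> D" "q \<in> D" "r \<in> D" "s \<in> D" using pqrs by auto
        moreover have "\<not> (card (nb v \<inter> A) = 1 \<and> card (nb w \<inter> A) = 1)" if "v \<in> D" "w \<in> D" "v \<noteq> w" for v w
          using n that by blast
        note this[OF m(1,2)] this[OF m(1,3)] this[OF m(1,4)] this[OF m(2,3)] this[OF m(2,4)] this[OF m(3,4)]
        ultimately show False using pqrs(2) le1[OF m(1)] le1[OF m(2)] le1[OF m(3)] le1[OF m(4)] by auto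
      qed
      then obtain a b where ab: "a \<in> D" "b \<in> D" "a \<noteq> b" "card (nb a \<inter> A) = 1" "card (nb b \<inter> A) = 1" by blast
      have "card (D - {a, b}) = 2" using c4 ab by (simp add: card_Diff_subset)
      then obtain c d where cd: "D - {a, b} = {c, d}" "c \<noteq> d" by (auto simp: card_2_iff)
      have Dl: "D = {a, b, c, d}" "distinct [a, b, c, d]" using cd ab by auto
      have B: "B = A \<union> {a, b, c, d}" using D Dl by simp
      have sub: "{a, b, c, d} \<subseteq> V" "{a, b, c, d} \<inter> A = {}" using D Dl by auto
      have perm: "{a, b, d, c} = {a, b, c, d}" "{b, a, c, d} = {a, b, c, d}" "{b, a, d, c} = {a, b, c, d}" by auto
      note cnt = four[OF Dl]
      have ad: "adj v w \<le> 1" for v w unfolding adj_def by simp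
      have adD: "adj v w = 1 \<Longrightarrow> w \<in> nb v" "adj v w = 1 \<Longrightarrow> v \<in> nb w"
        "adj v w = 0 \<Longrightarrow> w \<notin> nb v" "adj v w = 0 \<Longrightarrow> v \<notin> nb w" for v w
        using adj_iff[of v w] nb_sym[of v w] by simp_all
      have ab0: "adj a b = 0" using indep ab by blast
      have cd1: "card (nb c \<inter> A) \<le> 1" "card (nb d \<inter> A) \<le> 1" using b1 Dl by auto
      note ads = ad[of a c] ad[of a d] ad[of b c] ad[of b d] ad[of c d]
      consider (c) "card (nb c \<inter> A) = 1" | (d) "card (nb d \<inter> A) = 1"
        | (none) "card (nb c \<inter> A) = 0" "card (nb d \<inter> A) = 0" using cd1 by linarith
      then show ?thesis
      proof cases
        case c
        have z: "adj a c = 0" "adj b c = 0" using indep[of a c] indep[of b c] ab c Dl by auto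
        \<comment> \<open>Four attached vertices would be pairwise non-adjacent, making the count 4
          instead of 6.\<close>
        have "card (nb d \<inter> A) = 0"
        proof (rule ccontr)
          assume "card (nb d \<inter> A) \<noteq> 0"
          then have "card (nb d \<inter> A) = 1" using cd1 by linarith
          then have "adj a d = 0" "adj b d = 0" "adj c d = 0" using indep[of _ d] ab c Dl by auto
          then show False using cnt cd1 z ab0 ab c by linarith
        qed
        then have "adj a d = 1" "adj b d = 1" "adj c d = 1" using cnt z ab0 ab c ads by simp_all
        then show ?thesis unfolding B
          by (intro good_claw[OF A a4 sub Dl(2) ab(4,5) c]) (use adD z ab0 in auto)
      next
        case d
        have z: "adj a d = 0" "adj b d = 0" using indep[of a d] indep[of b d] ab d Dl by auto
        have "card (nb c \<inter> A) = 0"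
        proof (rule ccontr)
          assume "card (nb c \<inter> A) \<noteq> 0"
          then have "card (nb c \<inter> A) = 1" using cd1 by linarith
          then have "adj a c = 0" "adj b c = 0" "adj c d = 0" using indep[of _ c] indep[of c d] ab d Dl by auto
          then show False using cnt cd1 z ab0 ab d by linarith
        qed
        then have "adj a c = 1" "adj b c = 1" "adj c d = 1" using cnt z ab0 ab d ads by simp_all
        then show ?thesis unfolding B perm(1)[symmetric]
          by (intro good_claw[OF A a4 _ _ _ ab(4,5) d]) (use adD z ab0 sub Dl(2) in auto)
      next
        case none
        have sum: "adj a c + adj a d + adj b c + adj b d + adj c d = 4" using cnt none ab0 ab by linarith
        have A0: "nb c \<inter> A = {}" "nb d \<inter> A = {}" using none by simp_all
        \<comment> \<open>Besides \<open>a\<close>, \<open>b\<close> there are five pairs, and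
          exactly one of them is not an edge. If it is \<open>c\<close>, \<open>d\<close> this is
          the square; otherwise it is the triangle up to renaming.\<close>
        consider "adj c d = 0" | "adj b d = 0" | "adj b c = 0" | "adj a d = 0" | "adj a c = 0"
          using sum ads by linarith
        then show ?thesis
        proof cases
          case 1
          then have "adj a c = 1" "adj a d = 1" "adj b c = 1" "adj b d = 1" using sum ads by simp_all
          then show ?thesis unfolding B
            by (intro good_square[OF A a4 sub Dl(2) ab(4,5) A0]) (use adD 1 in auto)
        next
          case 2
          then have "adj a c = 1" "adj a d = 1" "adj b c = 1" "adj c d = 1" using sum ads by simp_all
          then show ?thesis unfolding B
            by (intro good_triangle[OF A a4 sub Dl(2) ab(4,5) A0]) (use adD 2 in auto)
        next
          case 3
          then have "adj a c = 1" "adj a d = 1" "adj b d = 1" "adj c d = 1" using sum ads by simp_all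
          then show ?thesis unfolding B perm(1)[symmetric]
            by (intro good_triangle[OF A a4 _ _ _ ab(4,5) A0(2,1)]) (use adD 3 sub Dl(2) in auto)
        next
          case 4
          then have "adj a c = 1" "adj b d = 1" "adj b c = 1" "adj c d = 1" using sum ads by simp_all
          then show ?thesis unfolding B perm(2)[symmetric]
            by (intro good_triangle[OF A a4 _ _ _ ab(5,4) A0]) (use adD 4 sub Dl(2) in auto)
        next
          case 5
          then have "adj a d = 1" "adj b d = 1" "adj b c = 1" "adj c d = 1" using sum ads by simp_all
          then show ?thesis unfolding B perm(3)[symmetric]
            by (intro good_triangle[OF A a4 _ _ _ ab(5,4) A0(2,1)]) (use adD 5 sub Dl(2) in auto)
        qed
      qed
    qed
  qed
qed

text \<open>Induction on the gap: a set with a small cut strictly in between divides the step.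
  Single vertices and their complements have 3-edge cuts, so an irreducible step from the empty set
  or up to \<open>V\<close> is one vertex.\<close>

lemma settled_step:
  assumes con: "k_connected 3 V E"
  shows "A \<subseteq> B \<Longrightarrow> B \<subseteq> V \<Longrightarrow> card (cut A) \<le> 4 \<Longrightarrow> card (cut B) \<le> 4 \<Longrightarrow> card (B - A) \<le> 5 \<Longrightarrow> settled A \<Longrightarrow> settled B"
proof (induction "card (B - A)" arbitrary: A B rule: less_induct)
  case less
  have fB: "finite B" using less.prems finite_sub by blast
  consider (eq) "A = B" | (mid) C where "A \<subset> C" "C \<subset> B" "card (cut C) \<le> 4"
    | (irr) "A \<subset> B" "\<And>C. A \<subset> C \<Longrightarrow> C \<subset> B \<Longrightarrow> 5 \<le> card (cut C)"
  proof (cases "A \<noteq> B \<and> (\<forall>C. A \<subset> C \<longrightarrow> C \<subset> B \<longrightarrow> 5 \<le> card (cut C))")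
    case True
    then show ?thesis using that(3) less.prems(1) by blast
  next
    case False
    then consider "A = B" | C where "A \<subset> C" "C \<subset> B" "\<not> 5 \<le> card (cut C)" by blast
    then show ?thesis by cases (use that(1,2) in auto)
  qed
  then show ?case
  proof cases
    case eq
    then show ?thesis using less.prems by simp
  next
    case mid
    have lt: "card (C - A) < card (B - A)" "card (B - C) < card (B - A)"
      using mid fB by (auto intro!: psubset_card_mono)
    have "settled C"
      by (rule less.hyps[OF lt(1)]) (use mid less.prems lt in auto)
    then show ?thesis
      by (intro less.hyps[OF lt(2)]) (use mid less.prems lt in auto)
  next
    case irr
    show ?thesis
    proof (cases "A = {}")
      case True
      then obtain v where v: "v \<in> B" using irr(1) by auto
      then have vV: "v \<in> V" using less.prems by auto
      have "card (cut {v}) = 3" using card_cut_insert[of v "{}"] vV by simp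
      then have "\<not> {v} \<subset> B" using irr(2)[of "{v}"] True by auto
      then have B: "B = {v}" using v by auto
      have "V \<noteq> {v}" using con unfolding k_connected_def by auto
      then show ?thesis using good_start[OF vV] B unfolding settled_def by auto
    next
      case ne: False
      have A: "A \<noteq> V" "good A" using less.prems irr(1) ne unfolding settled_def by auto
      show ?thesis
      proof (cases "B = V")
        case True
        then obtain v where v: "v \<in> V" "v \<notin> A" using irr(1) by blast
        have "card (cut (V - {v})) = 3" using cut_compl[of "{v}"] card_cut_insert[of v "{}"] v by simp
        then have "\<not> (A \<subset> V - {v})" using irr(2)[of "V - {v}"] v True by auto
        then have "V = insert v A" using v irr(1) True by auto
        then have "three_decomposition V E" using good_final[OF A(2) v(2)] by blast
        then show ?thesis using True unfolding settled_def by simp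
      next
        case False
        have "good B" by (rule good_irreducible[OF con irr(1) _ ne less.prems(3-5) A(2) irr(2)])
            (use False less.prems in auto)
        then show ?thesis using False unfolding settled_def by simp
      qed
    qed
  qed
qed

end

theorem theorem6:
  fixes V :: "'a set" and E :: "'a set set"
  assumes "simple_graph V E"
    and "cubic V E"
    and "k_connected 3 V E"
    and "pathwidth V E = 4"
  shows "three_decomposition V E"
proof -
  interpret cubic_graph V E by unfold_locales (rule assms)+
  have ne: "V \<noteq> {}" using assms(3) unfolding k_connected_def by auto
  have "settled V"
  proof (rule pathwidth_cut_induct[where Q = settled, OF assms(4) ne])
    show "settled {}" unfolding settled_def by simp
    show "settled B" if "A \<subseteq> B" "B \<subseteq> V" "card (cut A) \<le> 4" "card (cut B) \<le> 4" "card (B - A) \<le> Suc 4" "settled A"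
      for A B using settled_step[OF assms(3)] that by simp
  qed
  then show ?thesis using ne unfolding settled_def by blast
qed

end
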